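(* Let $A,B\in\mathbb{R}^{n\times(n+2)}$, where $A$ has full row rank and $\ker A\cap\mathbb{R}^{n+2}_{>}\neq\emptyset$. Let $A\,x^B=0$ be $n$ overlapping trinomials (after Gaussian elimination) involving $n+2$ monomials in $n$ positive variables $x\in\mathbb{R}^n_{>}$. Assume that (i) $\ker A$ is not a direct product, and (ii) $\ker\binom{B}{1_{n+2}^{\mathsf T}}\subset\mathbb{R}^{n+2}$ has dimension one. In particular, let $\bar y^1,\bar y^2\in\ker A\cap\mathbb{R}^{n+2}_{\ge}$ be the vertices of a coefficient polytope, let $$q=(\bar y^1-\bar y^2)\circ(\bar y^1+\bar y^2)^{-1}\in\mathbb{R}^{n+2},$$ and assume that $1=q_1\ge q_2\ge\dots\ge q_{n+2}=-1$ (after a simultaneous reordering of the columns of $A$ and $B$). Further, let $\ker\binom{B}{1_{n+2}^{\mathsf T}}=\operatorname{im} b$ with $b\in\mathbb{R}^{n+2}$, and let $s_i=\sum_{j=1}^i b_j$, $i=1,\dots,n+1$, be partial sums. Let $n_{A,B}$ be the number of distinct positive solutions $x\in\mathbb{R}^n_{>}$ of $A\,x^B=0$, and assume that $n_{A,B}$ is finite. Then $$n_{A,B}\le 1+Z(p_n)$$ with $$Z(p_n)\le\operatorname{sgnvar}\,(s_i)_{i=1}^{n+1},$$ where $p_n\colon(-1,1)\to\mathbb{R}$ is a univariate polynomial of degree at most $n$, defined by $$p_n(t)=\sum_{i=1}^{n+1}s_i\,(q_{i+1}-q_i)\prod_{j\in\{1,\dots,n+2\}\setminus\{i,i+1\}}(1+t\,q_j).$$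 If (consecutive) components of $q$ are equal, the latter bound can be further refined. Let $I_1,\dots,I_k\subset\{1,\dots,n+2\}$ be the corresponding equivalence classes of indices (under $i\sim j\Leftrightarrow q_i=q_j$), ordered so that the indices in $I_i$ precede those in $I_{i+1}$, let $\tilde b\in\mathbb{R}^k$ with $\tilde b_i=\sum_{j\in I_i}b_j$, and let $\tilde s_i=\sum_{j=1}^i\tilde b_j$, $i=1,\dots,k-1$, be partial sums. Then $$Z(p_n)\le\operatorname{sgnvar}\,(\tilde s_i)_{i=1}^{k-1}.$$
   Context: $\mathbb{R}_{>}$ and $\mathbb{R}_{\ge}$ denote the positive and nonnegative reals. For $x\in\mathbb{R}^n_{>}$ and $B=(b^1,\dots,b^m)\in\mathbb{R}^{n\times m}$, the vector of generalized monomials $x^B\in\mathbb{R}^m_{>}$ has components $(x^B)_j=x^{b^j}=\prod_{i=1}^n x_i^{b_{ij}}$ (real exponents). $\circ$ is the componentwise product and $v^{-1}$ the componentwise inverse; $1_m\in\mathbb{R}^m$ is the all-ones vector, appended to $B$ as an additional row. Direct product: $\ker A$ is a direct product if there is a partition of the column indices into two nonempty sets with corresponding column blocks $A_1,A_2$ of $A$ such that $\ker A=\ker A_1\times\ker A_2$ (up to the ordering of coordinates). Coefficient polytope: here $\ker A$ has dimension two, and the closed cone $\ker A\cap\mathbb{R}^{n+2}_{\ge}$ is generated by two non-proportional nonzero nonnegative vectors of minimal support. A (closed) coefficient polytope is a bounded section of this cone by an affine hyperplane meeting both extreme rays; it is a segment whose endpoints (vertices) $\bar y^1,\bar y^2$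 are such generators. In particular $\bar y^1+\bar y^2>0$ componentwise. $Z(p)$ denotes the number of distinct real zeros of $p$ on its interval of definition, here $(-1,1)$. $\operatorname{sgnvar}$ of a finite real sequence is its number of sign changes after deleting zeros.
   Formalization: If p_n is the zero polynomial, Z(p_n) is taken to be 0 instead of infinite; with Z = infinity the sign-variation bounds fail, e.g. for q = (1,0,0,-1), b = (0,1,-1,0) with no positive solutions. For p_n nonzero, Z is as stated. *)

theory Defs
  imports
    "Jordan_Normal_Form.Matrix_Kernel"
    "Jordan_Normal_Form.DL_Rank"
    "Jordan_Normal_Form.DL_Submatrix"
    "HOL-Computational_Algebra.Polynomial"
    Complex_Main
begin

text \<open>Vectors and matrices are indexed from 0: the component \<open>v\<^sub>i\<close> with \<open>i = 1, 2, \<dots>\<close>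
  is \<open>v $ (i - 1)\<close>, and likewise for matrix entries.\<close>

definition monomials :: "real vec \<Rightarrow> real mat \<Rightarrow> real vec" where
  "monomials x B = vec (dim_col B) (\<lambda>j. \<Prod>i<dim_row B. (x $ i) powr (B $$ (i, j)))"

definition positive_solutions :: "real mat \<Rightarrow> real mat \<Rightarrow> real vec set" where
  "positive_solutions A B =
    {x \<in> carrier_vec (dim_row B). (\<forall>i<dim_row B. 0 < x $ i) \<and> A *\<^sub>v monomials x B = 0\<^sub>v (dim_row A)}"

definition append_ones :: "real mat \<Rightarrow> real mat" where
  "append_ones B = B @\<^sub>r mat_of_row (vec (dim_col B) (\<lambda>_. 1))"

definition subvec :: "'a vec \<Rightarrow> nat set \<Rightarrow> 'a vec" where
  "subvec v J = vec (card J) (\<lambda>i. v $ pick J i)"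

text \<open>The reordering of coordinates identifies \<open>y\<close> with the pair \<open>(subvec y I, subvec y J)\<close>;
  the submatrices on all rows and the columns in \<open>I\<close> resp. \<open>J\<close> are the two column blocks.\<close>

definition kernel_direct_product :: "real mat \<Rightarrow> bool" where
  "kernel_direct_product A \<longleftrightarrow>
    (\<exists>I J. I \<noteq> {} \<and> J \<noteq> {} \<and> I \<inter> J = {} \<and> I \<union> J = {..<dim_col A} \<and>
      (\<forall>y \<in> carrier_vec (dim_col A). y \<in> mat_kernel A \<longleftrightarrow>
        subvec y I \<in> mat_kernel (submatrix A UNIV I) \<and>
        subvec y J \<in> mat_kernel (submatrix A UNIV J)))"

definition coefficient_cone :: "real mat \<Rightarrow> real vec set" where
  "coefficient_cone A = {y \<in> mat_kernel A. \<forall>i<dim_col A. 0 \<le> y $ i}"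

definition vec_support :: "real vec \<Rightarrow> nat set" where
  "vec_support v = {i. i < dim_vec v \<and> v $ i \<noteq> 0}"

definition cone_generator :: "real mat \<Rightarrow> real vec \<Rightarrow> bool" where
  "cone_generator A y \<longleftrightarrow> y \<in> coefficient_cone A \<and> vec_support y \<noteq> {} \<and>
    (\<forall>z \<in> coefficient_cone A. vec_support z \<noteq> {} \<longrightarrow> \<not> vec_support z \<subset> vec_support y)"

text \<open>A bounded section of the cone by an affine hyperplane \<open>h \<bullet> y = c\<close> that meets every
  extreme ray (in a point other than the origin).\<close>

definition coefficient_polytope :: "real mat \<Rightarrow> real vec set \<Rightarrow> bool" where
  "coefficient_polytope A P \<longleftrightarrow>
    (\<exists>h \<in> carrier_vec (dim_col A). h \<noteq> 0\<^sub>v (dim_col A) \<and>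
      (\<exists>c. P = {y \<in> coefficient_cone A. h \<bullet> y = c})) \<and>
    (\<exists>M. \<forall>y \<in> P. \<forall>i<dim_col A. \<bar>y $ i\<bar> \<le> M) \<and>
    (\<forall>y. cone_generator A y \<longrightarrow> (\<exists>r>0. r \<cdot>\<^sub>v y \<in> P))"

definition polytope_vertices :: "real vec set \<Rightarrow> real vec set" where
  "polytope_vertices P =
    {v \<in> P. \<forall>u \<in> P. \<forall>w \<in> P. \<forall>r. 0 < r \<and> r < 1 \<and> v = r \<cdot>\<^sub>v u + (1 - r) \<cdot>\<^sub>v w \<longrightarrow> u = w}"

definition vertex_quotient :: "real vec \<Rightarrow> real vec \<Rightarrow> real vec" where
  "vertex_quotient y1 y2 = vec (dim_vec y1) (\<lambda>i. (y1 $ i - y2 $ i) / (y1 $ i + y2 $ i))"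

definition partial_sum :: "real vec \<Rightarrow> nat \<Rightarrow> real" where
  "partial_sum b i = (\<Sum>j<i. b $ j)"

text \<open>With the index \<open>i\<close> of the sum starting at 1, the components \<open>q\<^sub>i\<close> and \<open>q\<^sub>i\<^sub>+\<^sub>1\<close> are
  \<open>q $ (i - 1)\<close> and \<open>q $ i\<close>.\<close>

definition trinomial_poly :: "nat \<Rightarrow> real vec \<Rightarrow> real vec \<Rightarrow> real poly" where
  "trinomial_poly n b q =
    (\<Sum>i = 1..n + 1. Polynomial.smult (partial_sum b i * (q $ i - q $ (i - 1)))
      (\<Prod>j \<in> {..<n + 2} - {i - 1, i}. [:1, q $ j:]))"

text \<open>The number of distinct zeros on the interval \<open>(-1,1)\<close>. The zero polynomial, for which
  this number is infinite, is assigned the value 0 by convention. It can occur with finitely many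
  (then no) positive solutions, for example if two columns of the exponent matrix agree; the
  bound by the number of sign changes is false for it without such a convention.\<close>

definition num_zeros :: "real poly \<Rightarrow> nat" where
  "num_zeros p = (if p = 0 then 0 else card {t. -1 < t \<and> t < 1 \<and> poly p t = 0})"

definition sgnvar :: "real list \<Rightarrow> nat" where
  "sgnvar xs = (let ys = filter (\<lambda>x. x \<noteq> 0) xs
    in card {i. Suc i < length ys \<and> ys ! i * ys ! Suc i < 0})"

text \<open>\<open>I 1, \<dots>, I k\<close> are the classes of indices with equal components of \<open>q\<close>, in increasing
  order.\<close>

definition ordered_classes :: "real vec \<Rightarrow> nat \<Rightarrow> (nat \<Rightarrow> nat set) \<Rightarrow> bool" where
  "ordered_classes q k I \<longleftrightarrow>
    bij_betw I {1..k} ({..<dim_vec q} // {(i, j). i < dim_vec q \<and> j < dim_vec q \<and> q $ i = q $ j}) \<and>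
    (\<forall>l m. 1 \<le> l \<and> l < m \<and> m \<le> k \<longrightarrow> (\<forall>i \<in> I l. \<forall>j \<in> I m. i < j))"

definition class_partial_sum :: "real vec \<Rightarrow> (nat \<Rightarrow> nat set) \<Rightarrow> nat \<Rightarrow> real" where
  "class_partial_sum b I i = (\<Sum>l = 1..i. \<Sum>j \<in> I l. b $ j)"

end

theory Submission
  imports Defs "HOL-Analysis.Equivalence_Lebesgue_Henstock_Integration"
begin

text \<open>
  The vertices \<open>y1\<close> and \<open>y2\<close> span the two-dimensional kernel of \<open>A\<close>, because the normalization
  of \<open>q\<close> says that \<open>y2\<close> vanishes in the first coordinate and \<open>y1\<close> in the last one, while the
  other vertex does not. A positive kernel vector is therefore a positive multiple of
  \<open>e \<circ> (1 + t q)\<close> with \<open>e = y1 + y2\<close> and a unique \<open>t \<in> (-1,1)\<close>. Taking logarithms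
  turns \<open>x\<^sup>B \<in> ker A\<close> into a linear system for \<open>ln x\<close> and the logarithm of the multiple. Its matrix is
  the transpose of \<open>B\<close> with the row of ones appended; this transpose is injective and its range is
  the orthogonal complement of \<open>b\<close>. Hence the positive solutions correspond to the zeros in
  \<open>(-1,1)\<close> of
    \<open>g(t) = \<Sum>\<^sub>k b\<^sub>k ln (e\<^sub>k (1 + t q\<^sub>k))\<close>,
  and by Rolle's theorem their number exceeds the number of zeros of
    \<open>D(t) = g'(t) = \<Sum>\<^sub>k b\<^sub>k q\<^sub>k / (1 + t q\<^sub>k)\<close>
  by at most one (\<open>card_positive_solutions_le_card_zeros\<close>). Summation by parts shows that \<open>D\<close> is
  \<open>- trinomial_poly\<close> divided by the positive product of all \<open>1 + t q\<^sub>k\<close>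
  (\<open>poly_trinomial_poly\<close>). If \<open>D\<close> vanishes identically, then \<open>g\<close> is constant, and there are either
  no positive solutions or infinitely many.

  The bound on the zeros of \<open>D\<close> is a continuous form of Descartes' rule of signs. Summation by
  parts and \<open>q / (1 + t q) = \<integral>\<^sub>0\<^sup>q dr / (1 + t r)\<^sup>2\<close> give
    \<open>D(t) = \<integral> s(r) / (1 + t r)\<^sup>2 dr\<close>,
  where the step function \<open>s\<close> equals the partial sum \<open>s\<^sub>i\<close> between \<open>q\<^sub>i\<^sub>+\<^sub>1\<close> and
  \<open>q\<^sub>i\<close>. More generally consider \<open>F(t) = \<integral> w(r) / (1 + t r)\<^sup>m dr\<close>, where \<open>w\<close> changes sign at
  the point \<open>\<rho>\<close>. The derivative of \<open>(1 + t \<rho>)\<^sup>m F(t)\<close> is, up to a nonvanishing factor, the same kind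
  of integral with exponent \<open>m + 1\<close> and weight \<open>w(r) (r - \<rho>)\<close>, which has one sign change less.
  So each sign change accounts for at most one zero by Rolle's theorem, and a weight without sign
  changes leaves no zero at all (\<open>card_zeros_kernel_sum\<close>).

  The refined bound is the same statement for the distinct values of \<open>q\<close>: grouping equal values in
  \<open>D\<close> does not change this function, but replaces \<open>b\<close> by the class sums.
\<close>

unbundle no vec_syntax
unbundle no inner_syntax
hide_const (open) Finite_Cartesian_Product.vec Finite_Cartesian_Product.mat
hide_type (open) Finite_Cartesian_Product.vec

section \<open>Counting zeros with Rolle's theorem\<close>

text \<open>Rolle's theorem gives a zero of the derivative between a zero and the next one, and these
  zeros of the derivative are distinct. The argument is run on finite sets of zeros, so that the
  finiteness of the whole set of zeros comes out of the resulting uniform bound.\<close>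

lemma finite_zeros_Rolle:
  fixes f f' :: "real \<Rightarrow> real"
  assumes der: "\<And>x. a < x \<Longrightarrow> x < b \<Longrightarrow> (f has_real_derivative f' x) (at x)"
    and fin: "finite {x. a < x \<and> x < b \<and> f' x = 0}"
  shows "finite {x. a < x \<and> x < b \<and> f x = 0}"
    and "card {x. a < x \<and> x < b \<and> f x = 0} \<le> Suc (card {x. a < x \<and> x < b \<and> f' x = 0})"
proof -
  let ?Z = "{x. a < x \<and> x < b \<and> f x = 0}" and ?Z' = "{x. a < x \<and> x < b \<and> f' x = 0}"
  have bound: "finite T \<and> card T \<le> Suc (card ?Z')" if T: "T \<subseteq> ?Z" "finite T" for T
  proof (cases "T = {}")
    case False
    define nxt where "nxt x = Min {y \<in> T. x < y}" for x
    have nxt: "nxt x \<in> T" "x < nxt x" "\<And>y. y \<in> T \<Longrightarrow> x < y \<Longrightarrow> nxt x \<le> y"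
      if "x \<in> T - {Max T}" for x
    proof -
      have "x < Max T" using that T by (simp add: order.not_eq_order_implies_strict)
      then have "{y \<in> T. x < y} \<noteq> {}" using T False Max_in[of T] by blast
      then have "nxt x \<in> {y \<in> T. x < y}" unfolding nxt_def using T by (intro Min_in) auto
      then show "nxt x \<in> T" "x < nxt x" by auto
      show "nxt x \<le> y" if "y \<in> T" "x < y" for y
        unfolding nxt_def using T that by (intro Min_le) auto
    qed
    have "\<exists>z. x < z \<and> z < nxt x \<and> f' z = 0" if x: "x \<in> T - {Max T}" for x
    proof -
      have inI: "a < z \<and> z < b" if "x \<le> z" "z \<le> nxt x" for z
        using that nxt(1)[OF x] x T(1) by force
      have "x \<in> ?Z" "nxt x \<in> ?Z" using nxt(1)[OF x] x T(1) by blast+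
      then have "f x = f (nxt x)" by simp
      moreover have "continuous_on {x..nxt x} f"
        using der inI by (meson DERIV_isCont atLeastAtMost_iff continuous_at_imp_continuous_on)
      ultimately obtain z where z: "x < z" "z < nxt x" "DERIV f z :> 0"
        using Rolle[of x "nxt x" f] nxt(2)[OF x] der inI
        by (metis less_imp_le real_differentiable_def)
      then have "f' z = 0" using DERIV_unique der inI less_imp_le by metis
      then show ?thesis using z by auto
    qed
    then obtain z where z: "\<And>x. x \<in> T - {Max T} \<Longrightarrow> x < z x \<and> z x < nxt x \<and> f' (z x) = 0"
      by metis
    have mono: "z x < z y" if "x \<in> T - {Max T}" "y \<in> T - {Max T}" "x < y" for x y
      using z[OF that(1)] z[OF that(2)] nxt(3)[OF that(1)] that by force
    have "inj_on z (T - {Max T})"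
      by (rule inj_onI) (metis mono less_irrefl linorder_neqE)
    moreover have "z ` (T - {Max T}) \<subseteq> ?Z'"
    proof
      fix w assume "w \<in> z ` (T - {Max T})"
      then obtain x where x: "x \<in> T - {Max T}" "w = z x" by auto
      have "a < x" using x T(1) by auto
      moreover have "nxt x < b" using nxt(1)[OF x(1)] T(1) by auto
      ultimately show "w \<in> ?Z'" using z[OF x(1)] x(2) by auto
    qed
    ultimately have "card (T - {Max T}) \<le> card ?Z'"
      using card_inj_on_le fin by blast
    then show ?thesis using T False by (simp add: card_Diff_singleton)
  qed (use T in auto)
  then show "finite ?Z" using finite_if_finite_subsets_card_bdd[of ?Z "Suc (card ?Z')"] by blast
  then show "card ?Z \<le> Suc (card ?Z')" using bound by blast
qed

section \<open>A rule of signs for integrals of \<open>w(r) / (1 + t r)\<^sup>m\<close>\<close>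

lemma one_plus_mult_pos:
  fixes t q :: real
  assumes "-1 < t" "t < 1" "-1 \<le> q" "q \<le> 1"
  shows "0 < 1 + t * q"
proof -
  have "\<bar>t * q\<bar> \<le> \<bar>t\<bar> * 1" unfolding abs_mult using assms by (intro mult_left_mono) auto
  then show ?thesis using assms by linarith
qed

lemma has_derivative_linear_power:
  fixes q x :: real
  shows "((\<lambda>t. (1 + t * q) ^ Suc m) has_field_derivative real (Suc m) * q * (1 + x * q) ^ m) (at x within S)"
proof -
  have "((\<lambda>t. 1 + t * q) has_field_derivative q) (at x within S)"
    by (auto intro!: derivative_eq_intros)
  from DERIV_power[OF this, of "Suc m"] show ?thesis by (simp add: mult_ac)
qed

text \<open>Multiplication with \<open>(1 + t r)\<^sup>m\<^sup>+\<^sup>1\<close> before differentiating is what makes the factor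
  \<open>q - r\<close> appear under the integral: the two terms of the product rule combine through
  \<open>r (1 + t q) - q (1 + t r) = r - q\<close>.\<close>

lemma has_derivative_kernel_integral:
  fixes v :: "real \<Rightarrow> real"
  assumes v: "continuous_on UNIV v" and ab: "-1 \<le> a" "b \<le> 1" and t: "-1 < t" "t < 1"
  shows "((\<lambda>t. (1 + t * r) ^ Suc m * integral {a..b} (\<lambda>q. v q / (1 + t * q) ^ Suc m))
     has_real_derivative
       - (real (Suc m) * (1 + t * r) ^ m * integral {a..b} (\<lambda>q. v q * (q - r) / (1 + t * q) ^ Suc (Suc m))))
     (at t)"
proof -
  have nz: "1 + t * q \<noteq> 0" if "-1 < t" "t < 1" "q \<in> {a..b}" for t q
    using one_plus_mult_pos[of t q] that ab by auto
  have cont_v: "continuous_on S (\<lambda>x. v (g x))" if "continuous_on S g" for S :: "'c::topological_space set" and g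
    using continuous_on_compose2[OF v that] by auto
  have int: "(\<lambda>q. w q / (1 + t * q) ^ k) integrable_on {a..b}"
    if "continuous_on {a..b} w" "-1 < t" "t < 1" for w t k
    using that nz by (intro integrable_continuous_real continuous_intros) auto
  have L: "((\<lambda>t. integral (cbox a b) (\<lambda>q. v q / (1 + t * q) ^ Suc m)) has_field_derivative
      integral (cbox a b) (\<lambda>q. - (real (Suc m) * q * v q / (1 + t * q) ^ Suc (Suc m)))) (at t within {-1<..<1})"
  proof (rule leibniz_rule_field_derivative)
    fix x q :: real assume x: "x \<in> {-1<..<1}" "q \<in> cbox a b"
    define P where "P = 1 + x * q"
    have n: "P \<noteq> 0" using x nz by (auto simp: P_def)
    from DERIV_divide[OF DERIV_const[of "v q"] has_derivative_linear_power[of q m x "{-1<..<1}"]]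
    have "((\<lambda>t. v q / (1 + t * q) ^ Suc m) has_field_derivative
      (0 * P ^ Suc m - v q * (real (Suc m) * q * P ^ m)) / (P ^ Suc m * P ^ Suc m)) (at x within {-1<..<1})"
      using n by (simp add: P_def)
    also have "(0 * P ^ Suc m - v q * (real (Suc m) * q * P ^ m)) / (P ^ Suc m * P ^ Suc m)
      = - (real (Suc m) * q * v q / P ^ Suc (Suc m))"
      using n by (simp add: divide_simps del: of_nat_Suc)
    finally    show "((\<lambda>t. v q / (1 + t * q) ^ Suc m) has_field_derivative
      - (real (Suc m) * q * v q / (1 + x * q) ^ Suc (Suc m))) (at x within {-1<..<1})"
      unfolding P_def .
  next
    show "(\<lambda>q. v q / (1 + x * q) ^ Suc m) integrable_on cbox a b" if "x \<in> {-1<..<1}" for x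
      unfolding cbox_interval by (rule int[OF continuous_on_subset[OF v]]) (use that in auto)
  next
    show "continuous_on ({-1<..<1} \<times> cbox a b)
       (\<lambda>(x, q). - (real (Suc m) * q * v q / (1 + x * q) ^ Suc (Suc m)))"
      unfolding split_beta using nz
      by (intro continuous_intros cont_v) auto
  qed (use t in auto)
  have L': "((\<lambda>t. integral {a..b} (\<lambda>q. v q / (1 + t * q) ^ Suc m)) has_field_derivative
      integral {a..b} (\<lambda>q. - (real (Suc m) * q * v q / (1 + t * q) ^ Suc (Suc m)))) (at t)"
    using L at_within_open[of t "{-1<..<1}"] t by auto
  note P = has_derivative_linear_power[of r m t UNIV]
  have v': "continuous_on {a..b} v" using v continuous_on_subset by blast
  have i1: "(\<lambda>q. v q / (1 + t * q) ^ Suc m) integrable_on {a..b}"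
    using int[OF v' t] .
  have i2: "(\<lambda>q. q * v q / (1 + t * q) ^ Suc (Suc m)) integrable_on {a..b}"
    using v' t by (intro int continuous_intros) auto
  have "real (Suc m) * r * (1 + t * r) ^ m * integral {a..b} (\<lambda>q. v q / (1 + t * q) ^ Suc m)
      + integral {a..b} (\<lambda>q. - (real (Suc m) * q * v q / (1 + t * q) ^ Suc (Suc m))) * (1 + t * r) ^ Suc m
    = real (Suc m) * (1 + t * r) ^ m * (r * integral {a..b} (\<lambda>q. v q / (1 + t * q) ^ Suc m)
        - (1 + t * r) * integral {a..b} (\<lambda>q. q * v q / (1 + t * q) ^ Suc (Suc m)))"
  proof -
    have alg: "c * r * z * X + - c * Y * (p * z) = c * z * (r * X - p * Y)" for c z X Y p :: real
      by (simp add: algebra_simps)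
    have E: "integral {a..b} (\<lambda>q. - (real (Suc m) * q * v q / (1 + t * q) ^ Suc (Suc m)))
      = - real (Suc m) * integral {a..b} (\<lambda>q. q * v q / (1 + t * q) ^ Suc (Suc m))"
      unfolding integral_mult_right[symmetric]
      by (rule arg_cong[where f="integral {a..b}"]) (simp only: mult.assoc mult_minus_left times_divide_eq_right minus_divide_left)
    show ?thesis unfolding E unfolding power_Suc by (rule alg)
  qed
  also have "r * integral {a..b} (\<lambda>q. v q / (1 + t * q) ^ Suc m)
        - (1 + t * r) * integral {a..b} (\<lambda>q. q * v q / (1 + t * q) ^ Suc (Suc m))
    = integral {a..b} (\<lambda>q. r * (v q / (1 + t * q) ^ Suc m) - (1 + t * r) * (q * v q / (1 + t * q) ^ Suc (Suc m)))"
    using i1 i2 by (simp only: integral_mult_right[symmetric] integral_diff integrable_on_mult_right)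
  also have "\<dots> = integral {a..b} (\<lambda>q. - (v q * (q - r) / (1 + t * q) ^ Suc (Suc m)))"
  proof (rule integral_cong)
    fix q assume "q \<in> {a..b}"
    then have "1 + t * q \<noteq> 0" using nz t by auto
    then show "r * (v q / (1 + t * q) ^ Suc m) - (1 + t * r) * (q * v q / (1 + t * q) ^ Suc (Suc m))
      = - (v q * (q - r) / (1 + t * q) ^ Suc (Suc m))"
      by (simp add: divide_simps) (simp add: algebra_simps)
  qed
  finally have eq: "real (Suc m) * r * (1 + t * r) ^ m * integral {a..b} (\<lambda>q. v q / (1 + t * q) ^ Suc m)
      + integral {a..b} (\<lambda>q. - (real (Suc m) * q * v q / (1 + t * q) ^ Suc (Suc m))) * (1 + t * r) ^ Suc m
    = real (Suc m) * (1 + t * r) ^ m * integral {a..b} (\<lambda>q. - (v q * (q - r) / (1 + t * q) ^ Suc (Suc m)))" .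
  show ?thesis using DERIV_mult[OF P L'] unfolding eq unfolding integral_neg mult_minus_right .
qed

text \<open>The list \<open>rs\<close> contains the sign changes of the weight, which is \<open>c i * v q\<close> on the interval
  from \<open>a i\<close> to \<open>b i\<close>: multiplied with all \<open>q - r\<close> it becomes nonnegative. In the induction
  the factor for the first sign change moves into the continuous part \<open>v\<close>, at the price of one
  application of Rolle's theorem.\<close>

lemma card_zeros_kernel_sum:
  fixes J :: "'i set" and c a b :: "'i \<Rightarrow> real" and v :: "real \<Rightarrow> real"
  defines "F \<equiv> \<lambda>v m t. \<Sum>i\<in>J. c i * integral {a i..b i} (\<lambda>q. v q / (1 + t * q) ^ Suc m)"
  assumes J: "finite J" and ab: "\<And>i. i \<in> J \<Longrightarrow> -1 \<le> a i \<and> b i \<le> 1"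
    and v: "continuous_on UNIV v"
    and rs: "\<And>r. r \<in> set rs \<Longrightarrow> -1 \<le> r \<and> r \<le> 1"
    and nonneg: "\<And>i q. i \<in> J \<Longrightarrow> a i \<le> q \<Longrightarrow> q \<le> b i \<Longrightarrow> 0 \<le> c i * v q * (\<Prod>r\<leftarrow>rs. q - r)"
    and pos: "\<exists>i\<in>J. \<exists>q. a i < q \<and> q < b i \<and> 0 < c i * v q * (\<Prod>r\<leftarrow>rs. q - r)"
  shows "finite {t. -1 < t \<and> t < 1 \<and> F v m t = 0} \<and>
    card {t. -1 < t \<and> t < 1 \<and> F v m t = 0} \<le> length rs"
  using v rs nonneg pos
proof (induction rs arbitrary: v m)
  case Nil
  have "F v m t > 0" if t: "-1 < t" "t < 1" for t
  proof -
    have den: "0 < (1 + t * q) ^ Suc m" if "i \<in> J" "q \<in> {a i..b i}" for i q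
      using one_plus_mult_pos[of t q] that ab[of i] t by (intro zero_less_power) auto
    have cont: "continuous_on {a i..b i} (\<lambda>q. c i * (v q / (1 + t * q) ^ Suc m))" if "i \<in> J" for i
      using den[OF that] continuous_on_subset[OF Nil.prems(1)]
      by (intro continuous_intros) force+
    have nn: "0 \<le> c i * (v q / (1 + t * q) ^ Suc m)" if "i \<in> J" "q \<in> {a i..b i}" for i q
      using Nil.prems(3)[of i q] den[OF that] that by (simp add: divide_nonneg_pos flip: times_divide_eq_right)
        (metis divide_nonneg_pos times_divide_eq_right)
    have ge: "0 \<le> integral {a i..b i} (\<lambda>q. c i * (v q / (1 + t * q) ^ Suc m))" if "i \<in> J" for i
      using nn[OF that] by (intro integral_nonneg integrable_continuous_real cont that)
    obtain i q where i: "i \<in> J" "a i < q" "q < b i" "0 < c i * v q" using Nil.prems(4) by auto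
    have "0 \<noteq> c i * (v q / (1 + t * q) ^ Suc m)" using i den[of i q] by auto
    then have "integral {a i..b i} (\<lambda>q. c i * (v q / (1 + t * q) ^ Suc m)) \<noteq> 0"
      using integral_eq_0_iff[OF cont[OF i(1)]] nn[OF i(1)] i by fastforce
    then have gt: "0 < integral {a i..b i} (\<lambda>q. c i * (v q / (1 + t * q) ^ Suc m))"
      using ge[OF i(1)] by simp
    show ?thesis unfolding F_def integral_mult_right[symmetric]
      using J i(1) ge gt by (intro sum_pos2[of J i]) auto
  qed
  then have "{t. -1 < t \<and> t < 1 \<and> F v m t = 0} = {}" by force
  then show ?case by (simp only:) simp
next
  case (Cons r rs)
  define w where "w q = v q * (q - r)" for q
  define Z where "Z = {t. -1 < t \<and> t < 1 \<and> F w (Suc m) t = 0}"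
  have IH: "finite Z \<and> card Z \<le> length rs"
    unfolding Z_def
  proof (rule Cons.IH)
    show "continuous_on UNIV w" unfolding w_def using Cons.prems(1) by (intro continuous_intros)
  qed (use Cons.prems(2,3,4) in \<open>auto simp: w_def mult.assoc\<close>)
  let ?H = "\<lambda>t. (1 + t * r) ^ Suc m * F v m t"
  let ?H' = "\<lambda>t. - (real (Suc m) * (1 + t * r) ^ m * F w (Suc m) t)"
  have r: "0 < 1 + t * r" if "-1 < t" "t < 1" for t
    using one_plus_mult_pos that Cons.prems(2)[of r] by auto
  have der: "(?H has_real_derivative ?H' t) (at t)" if t: "-1 < t" "t < 1" for t
  proof -
    have "((\<lambda>t. \<Sum>i\<in>J. c i * ((1 + t * r) ^ Suc m * integral {a i..b i} (\<lambda>q. v q / (1 + t * q) ^ Suc m)))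
      has_real_derivative
       (\<Sum>i\<in>J. c i * - (real (Suc m) * (1 + t * r) ^ m * integral {a i..b i} (\<lambda>q. v q * (q - r) / (1 + t * q) ^ Suc (Suc m))))) (at t)"
      using ab t by (intro DERIV_sum DERIV_cmult has_derivative_kernel_integral Cons.prems(1)) auto
    then show ?thesis unfolding F_def w_def sum_distrib_left sum_negf[symmetric]
      by (simp add: mult_ac)
  qed
  have Z': "{t. -1 < t \<and> t < 1 \<and> ?H' t = 0} = Z"
    unfolding Z_def using r by (auto simp del: of_nat_Suc) (metis less_irrefl power_eq_0_iff r)+
  have Z0: "{t. -1 < t \<and> t < 1 \<and> ?H t = 0} = {t. -1 < t \<and> t < 1 \<and> F v m t = 0}"
    using r by force
  show ?case
    using finite_zeros_Rolle[of "-1" 1 ?H ?H', OF der] IH unfolding Z' Z0 by auto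
qed

section \<open>Sign changes of a step function\<close>

lemma sgnvar_single: "sgnvar [x] = 0"
  by (auto simp: sgnvar_def Let_def)

lemma sgnvar_filter_nonzero: "sgnvar (filter (\<lambda>x. x \<noteq> 0) xs) = sgnvar xs"
  by (simp add: sgnvar_def)

lemma sgnvar_Cons_Cons:
  assumes "x \<noteq> 0" "y \<noteq> 0"
  shows "sgnvar (x # y # xs) = (if x * y < 0 then 1 else 0) + sgnvar (y # xs)"
proof -
  define ys where "ys = y # filter (\<lambda>x. x \<noteq> 0) xs"
  let ?S = "\<lambda>ys :: real list. {i. Suc i < length ys \<and> ys ! i * ys ! Suc i < 0}"
  have "?S (x # ys) = (if x * y < 0 then {0} else {}) \<union> Suc ` ?S ys"
  proof (rule Set.set_eqI)
    fix i
    have "ys ! 0 = y" "0 < length ys" by (simp_all add: ys_def)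
    then show "i \<in> ?S (x # ys) \<longleftrightarrow> i \<in> (if x * y < 0 then {0} else {}) \<union> Suc ` ?S ys"
      by (cases i) (auto simp: inj_image_mem_iff)
  qed
  moreover have "finite (?S ys)" by (rule finite_subset[of _ "{..length ys}"]) auto
  ultimately have "card (?S (x # ys)) = (if x * y < 0 then 1 else 0) + card (?S ys)"
    by (auto simp: card_image card_insert_if)
  then show ?thesis using assms by (simp add: sgnvar_def ys_def Let_def)
qed

text \<open>An entry \<open>(c, a, b)\<close> of the list stands for the value \<open>c\<close> of a step function on the interval
  from \<open>a\<close> to \<open>b\<close>; the intervals are listed from right to left. A root is placed at the left end
  of every interval after which the sign changes, which gives a polynomial with the sign
  pattern of the step function. The bound on the roots by the left end of the first interval
  makes the polynomial nonnegative on any interval further right, so that the list can be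
  extended at its head.\<close>

lemma sign_pattern_roots:
  fixes L :: "(real \<times> real \<times> real) list"
  assumes "L \<noteq> []"
    and "sorted_wrt (\<lambda>(c, a, b) (c', a', b'). b' \<le> a) L"
    and "\<And>c a b. (c, a, b) \<in> set L \<Longrightarrow> c \<noteq> 0 \<and> a \<le> b"
  shows "\<exists>rs. length rs = sgnvar (map fst L) \<and>
    (\<forall>r\<in>set rs. r \<le> fst (snd (hd L)) \<and> (\<exists>c b. (c, r, b) \<in> set L)) \<and>
    (\<forall>(c, a, b)\<in>set L. \<forall>q\<in>{a..b}. 0 \<le> fst (hd L) * c * (\<Prod>r\<leftarrow>rs. q - r))"
  using assms
proof (induction L rule: induct_list012)
  case (2 e)
  then show ?case by (intro exI[of _ "[]"]) (auto simp: sgnvar_single)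
next
  case (3 e f L)
  obtain c a b where e: "e = (c, a, b)" by (cases e)
  obtain c' a' b' where f: "f = (c', a', b')" by (cases f)
  have ne: "c \<noteq> 0" "c' \<noteq> 0" "a \<le> b" "a' \<le> b'" "b' \<le> a"
    using 3(4) 3(5)[of c a b] 3(5)[of c' a' b'] by (auto simp: e f)
  have le: "b'' \<le> a" if "(c'', a'', b'') \<in> set (f # L)" for c'' a'' b''
    using 3(4) that by (auto simp: e)
  obtain rs where rs: "length rs = sgnvar (map fst (f # L))"
    and rs_le: "\<And>r. r \<in> set rs \<Longrightarrow> r \<le> a' \<and> (\<exists>c b. (c, r, b) \<in> set (f # L))"
    and sgn: "\<And>c a b q. (c, a, b) \<in> set (f # L) \<Longrightarrow> q \<in> {a..b} \<Longrightarrow> 0 \<le> c' * c * (\<Prod>r\<leftarrow>rs. q - r)"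
    using 3(2)[OF _ _ 3(5)] 3(4) unfolding f by fastforce
  have head: "0 \<le> (\<Prod>r\<leftarrow>rs. q - r)" if "a \<le> q" for q
    using rs_le ne that by (intro prod_list_nonneg) force
  have hd: "fst (hd (e # f # L)) = c" by (simp add: e)
  show ?case
  proof (cases "c * c' < 0")
    case True
    have "0 \<le> c * c'' * (\<Prod>r\<leftarrow>a # rs. q - r)"
      if "(c'', a'', b'') \<in> set (e # f # L)" "q \<in> {a''..b''}" for c'' a'' b'' q
    proof (cases "(c'', a'', b'') \<in> set (f # L)")
      case T: True
      have "0 \<le> (- (c * c') * (a - q)) * (c' * c'' * (\<Prod>r\<leftarrow>rs. q - r))"
      proof (rule mult_nonneg_nonneg[OF mult_nonneg_nonneg])
        show "0 \<le> - (c * c')" "0 \<le> a - q" using True le[OF T] that(2) by auto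
      qed (rule sgn[OF T that(2)])
      also have "\<dots> = c'\<^sup>2 * (c * c'' * (\<Prod>r\<leftarrow>a # rs. q - r))"
        by (simp add: power2_eq_square algebra_simps)
      finally show ?thesis using ne by (simp add: zero_le_mult_iff)
    next
      case False
      then have "c'' = c" "a'' = a" "b'' = b" using that by (auto simp: e)
      then show ?thesis using head[of q] that by simp
    qed
    moreover have "\<forall>r\<in>set (a # rs). r \<le> a \<and> (\<exists>c b. (c, r, b) \<in> set (e # f # L))"
      using rs_le ne by (fastforce simp: e)
    ultimately show ?thesis
      using True rs sgnvar_Cons_Cons[OF ne(1,2), of "map fst L"] unfolding hd
      by (intro exI[of _ "a # rs"] conjI) (simp add: e f, simp add: e, blast)
  next
    case False
    then have cc: "c * c' > 0" using ne by (simp add: linorder_not_less order_le_less)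
    have "0 \<le> c * c'' * (\<Prod>r\<leftarrow>rs. q - r)"
      if "(c'', a'', b'') \<in> set (e # f # L)" "q \<in> {a''..b''}" for c'' a'' b'' q
    proof (cases "(c'', a'', b'') \<in> set (f # L)")
      case T: True
      have "0 \<le> (c * c') * (c' * c'' * (\<Prod>r\<leftarrow>rs. q - r))"
        by (rule mult_nonneg_nonneg[OF less_imp_le[OF cc] sgn[OF T that(2)]])
      also have "\<dots> = c'\<^sup>2 * (c * c'' * (\<Prod>r\<leftarrow>rs. q - r))"
        by (simp add: power2_eq_square algebra_simps)
      finally show ?thesis using ne by (simp add: zero_le_mult_iff)
    next
      case False
      then have "c'' = c" "a'' = a" "b'' = b" using that by (auto simp: e)
      then show ?thesis using head[of q] that by simp
    qed
    moreover have "\<forall>r\<in>set rs. r \<le> a \<and> (\<exists>c b. (c, r, b) \<in> set (e # f # L))"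
      using rs_le ne by fastforce
    ultimately show ?thesis
      using False rs sgnvar_Cons_Cons[OF ne(1,2), of "map fst L"] unfolding hd
      by (intro exI[of _ rs] conjI) (simp add: e f, simp add: e, blast)
  qed
qed simp

lemma sum_by_parts:
  fixes \<beta> u :: "nat \<Rightarrow> real"
  shows "(\<Sum>j<Suc m. \<beta> j * u j) =
    (\<Sum>i<m. (\<Sum>j<Suc i. \<beta> j) * (u i - u (Suc i))) + (\<Sum>j<Suc m. \<beta> j) * u m"
  by (induction m) (simp_all add: algebra_simps)

text \<open>An antiderivative of \<open>q \<mapsto> 1 / (1 + t q)\<^sup>2\<close> is \<open>q / (1 + t q)\<close>. The exponent is written
  \<open>Suc 1\<close> to match \<open>card_zeros_kernel_sum\<close>.\<close>

lemma integral_kernel: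
  fixes t a b :: real
  assumes "-1 < t" "t < 1" "-1 \<le> a" "a \<le> b" "b \<le> 1"
  shows "integral {a..b} (\<lambda>q. 1 / (1 + t * q) ^ Suc 1) = b / (1 + t * b) - a / (1 + t * a)"
proof (rule integral_unique, rule fundamental_theorem_of_calculus)
  fix q assume "q \<in> {a..b}"
  then have "1 + t * q \<noteq> 0" using one_plus_mult_pos[of t q] assms by auto
  then have "((\<lambda>q. q / (1 + t * q)) has_real_derivative 1 / (1 + t * q) ^ Suc 1) (at q within {a..b})"
    by (auto intro!: derivative_eq_intros simp: divide_simps) 
  then show "((\<lambda>q. q / (1 + t * q)) has_vector_derivative 1 / (1 + t * q) ^ Suc 1) (at q within {a..b})"
    by (simp add: has_real_derivative_iff_has_vector_derivative)
qed (use assms in simp)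

text \<open>Summation by parts writes \<open>D\<close> as the integral of \<open>s(r) / (1 + t r)\<^sup>2\<close> with the step
  function \<open>s\<close> of partial sums; the boundary term vanishes because the total sum does. Intervals with
  partial sum zero are dropped, as deleting zeros does not affect the number of sign changes. The
  points \<open>x j\<close> may coincide, which only makes some intervals degenerate.\<close>

lemma card_zeros_le_sgnvar:
  fixes \<beta> x :: "nat \<Rightarrow> real" and k :: nat
  defines "D \<equiv> \<lambda>t. \<Sum>j<k. \<beta> j * (x j / (1 + t * x j))"
    and "s \<equiv> \<lambda>i. \<Sum>j<i. \<beta> j"
  assumes mono: "\<And>i j. i \<le> j \<Longrightarrow> j < k \<Longrightarrow> x j \<le> x i"
    and bd: "\<And>i. i < k \<Longrightarrow> -1 \<le> x i \<and> x i \<le> 1"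
    and s0: "s k = 0"
    and nz: "-1 < t0" "t0 < 1" "D t0 \<noteq> 0"
  shows "card {t. -1 < t \<and> t < 1 \<and> D t = 0} \<le> sgnvar (map s [1..<k])"
proof -
  have "k \<noteq> 0" using nz(3) by (cases k) (auto simp: D_def)
  then obtain m where k: "k = Suc m" using not0_implies_Suc by blast
  define J where "J = filter (\<lambda>i. s (Suc i) \<noteq> 0) [0..<m]"
  define L where "L = map (\<lambda>i. (s (Suc i), x (Suc i), x i)) J"
  let ?F = "\<lambda>v t. \<Sum>i\<in>set J. s (Suc i) * integral {x (Suc i)..x i} (\<lambda>q. v q / (1 + t * q) ^ Suc 1)"
  have D: "D t = ?F (\<lambda>_. 1) t" if t: "-1 < t" "t < 1" for t
  proof -
    have "D t = (\<Sum>i<m. s (Suc i) * (x i / (1 + t * x i) - x (Suc i) / (1 + t * x (Suc i))))"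
      using sum_by_parts[of \<beta> "\<lambda>j. x j / (1 + t * x j)" m] s0 by (simp add: D_def s_def k)
    also have "\<dots> = (\<Sum>i<m. s (Suc i) * integral {x (Suc i)..x i} (\<lambda>q. 1 / (1 + t * q) ^ Suc 1))"
      using mono bd t k by (intro sum.cong refl arg_cong2[where f="(*)"] integral_kernel[symmetric]) auto
    also have "\<dots> = ?F (\<lambda>_. 1) t"
      by (rule sum.mono_neutral_right) (auto simp: J_def)
    finally show ?thesis .
  qed
  have "\<exists>i\<in>set J. x (Suc i) \<noteq> x i"
  proof (rule ccontr)
    assume "\<not> ?thesis"
    then have "D t0 = 0" unfolding D[OF nz(1,2)] by (intro sum.neutral) auto
    then show False using nz by simp
  qed
  then obtain i0 where i0: "i0 \<in> set J" "x (Suc i0) \<noteq> x i0" by blast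
  then have "Suc i0 < k" by (simp add: J_def k)
  then have i0: "i0 \<in> set J" "x (Suc i0) < x i0"
    using mono[of i0 "Suc i0"] i0 by simp_all
  have "L \<noteq> []" using i0 by (auto simp: L_def)
  moreover have "sorted_wrt (\<lambda>(c, a, b) (c', a', b'). b' \<le> a) L"
  proof -
    have "sorted_wrt (<) J" unfolding J_def by (intro sorted_wrt_filter) simp
    then show ?thesis unfolding L_def sorted_wrt_map
      by (rule sorted_wrt_mono_rel[rotated]) (use mono k in \<open>auto simp: J_def\<close>)
  qed
  moreover have "c \<noteq> 0 \<and> a \<le> b" if "(c, a, b) \<in> set L" for c a b
    using that mono k by (auto simp: L_def J_def)
  ultimately obtain rs where rs: "length rs = sgnvar (map fst L)"
    and rs': "\<And>r. r \<in> set rs \<Longrightarrow> \<exists>c b. (c, r, b) \<in> set L"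
    and sgn: "\<And>c a b q. (c, a, b) \<in> set L \<Longrightarrow> q \<in> {a..b} \<Longrightarrow> 0 \<le> fst (hd L) * c * (\<Prod>r\<leftarrow>rs. q - r)"
    using sign_pattern_roots[of L] by fastforce
  \<comment> \<open>The sign pattern is only determined up to the sign of the first value, which goes into \<open>v\<close>.\<close>
  define \<epsilon> where "\<epsilon> = fst (hd L)"
  have \<epsilon>: "\<epsilon> \<noteq> 0" using \<open>L \<noteq> []\<close> hd_in_set[of L] by (auto simp: \<epsilon>_def L_def J_def)
  have len: "length rs = sgnvar (map s [1..<k])"
  proof -
    have "map fst L = filter (\<lambda>y. y \<noteq> 0) (map (\<lambda>i. s (Suc i)) [0..<m])"
      by (simp add: L_def J_def filter_map o_def)
    also have "map (\<lambda>i. s (Suc i)) [0..<m] = map s [1..<k]"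
      using map_Suc_upt[of 0 m] by (simp add: k flip: map_map[unfolded o_def])
    finally show ?thesis using rs by (simp add: sgnvar_filter_nonzero)
  qed
  \<comment> \<open>Away from the finitely many roots the weighted step function is strictly positive.\<close>
  have "infinite ({x (Suc i0)<..<x i0} - set rs)" using i0(2) by simp
  then obtain q0 where q0: "x (Suc i0) < q0" "q0 < x i0" "q0 \<notin> set rs"
    by (metis Diff_iff ex_in_conv finite.emptyI greaterThanLessThan_iff)
  have zeros: "finite {t. -1 < t \<and> t < 1 \<and> ?F (\<lambda>_. \<epsilon>) t = 0} \<and>
    card {t. -1 < t \<and> t < 1 \<and> ?F (\<lambda>_. \<epsilon>) t = 0} \<le> length rs"
  proof (rule card_zeros_kernel_sum)
    show "-1 \<le> x (Suc i) \<and> x i \<le> 1" if "i \<in> set J" for i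
      using that bd k by (auto simp: J_def)
    show "-1 \<le> r \<and> r \<le> 1" if "r \<in> set rs" for r
      using rs'[OF that] bd k by (auto simp: L_def J_def)
    show nn: "0 \<le> s (Suc i) * \<epsilon> * (\<Prod>r\<leftarrow>rs. q - r)" if "i \<in> set J" "x (Suc i) \<le> q" "q \<le> x i" for i q
      using sgn[of "s (Suc i)" "x (Suc i)" "x i" q] that by (auto simp: L_def \<epsilon>_def mult_ac)
    have "s (Suc i0) * \<epsilon> * (\<Prod>r\<leftarrow>rs. q0 - r) \<noteq> 0"
      using q0 i0 \<epsilon> by (auto simp: J_def prod_list_zero_iff)
    then have "0 < s (Suc i0) * \<epsilon> * (\<Prod>r\<leftarrow>rs. q0 - r)"
      using nn[of i0 q0] i0 q0 by (simp add: order_less_le)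
    then show "\<exists>i\<in>set J. \<exists>q>x (Suc i). q < x i \<and> 0 < s (Suc i) * \<epsilon> * (\<Prod>r\<leftarrow>rs. q - r)"
      using i0 q0 by blast
  qed auto
  have "?F (\<lambda>_. \<epsilon>) t = \<epsilon> * ?F (\<lambda>_. 1) t" for t
  proof -
    have "integral S (\<lambda>q. \<epsilon> / (1 + t * q) ^ Suc 1) = \<epsilon> * integral S (\<lambda>q. 1 / (1 + t * q) ^ Suc 1)" for S
      by (simp flip: integral_mult_right)
    then show ?thesis unfolding sum_distrib_left by (simp add: mult_ac)
  qed
  then have "{t. -1 < t \<and> t < 1 \<and> D t = 0} = {t. -1 < t \<and> t < 1 \<and> ?F (\<lambda>_. \<epsilon>) t = 0}"
    using D \<epsilon> by auto
  then show ?thesis using zeros len by simp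
qed

section \<open>Kernels and row spaces\<close>

text \<open>Full row rank is rank equal to the number of rows, so the columns span the whole space; a vector
  annihilated by the transpose is orthogonal to all columns, hence zero.\<close>

lemma (in vec_space) trans_mult_vec_eq_0_of_rank:
  fixes A :: "'a mat"
  assumes A: "A \<in> carrier_mat n nc" and r: "rank A = n"
    and w: "w \<in> carrier_vec n" and 0: "A\<^sup>T *\<^sub>v w = 0\<^sub>v nc"
  shows "w = 0\<^sub>v n"
proof -
  obtain S where S: "finite S" "maximal S (\<lambda>T. T \<subseteq> set (cols A) \<and> lin_indpt T)"
    using maximal_exists_superset[of "set (cols A)" "\<lambda>T. T \<subseteq> set (cols A) \<and> lin_indpt T" "{}"]
    by (auto simp: lin_dep_def)
  have S': "S \<subseteq> set (cols A)" "lin_indpt S" using S(2) by (auto simp: maximal_def)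
  have c: "set (cols A) \<subseteq> carrier_vec n" using A cols_dim by blast
  have "basis S"
  proof (rule dim_li_is_basis)
    show "card S \<ge> dim" using rank_card_indpt[OF A S(2)] r dim_is_n by linarith
  qed (use S S' c in auto)
  then have "carrier_vec n \<subseteq> span S" by (simp add: basis_def)
  then have "carrier_vec n \<subseteq> col_space A"
    unfolding col_space_def using span_is_monotone[OF S'(1)] by blast
  then have sp: "\<exists>x\<in>carrier_vec nc. A *\<^sub>v x = y" if "y \<in> carrier_vec n" for y
    using col_space_eq[OF A] A that by auto
  have "w $ i = 0" if i: "i < n" for i
  proof -
    obtain x where x: "x \<in> carrier_vec nc" "A *\<^sub>v x = unit_vec n i" using sp[of "unit_vec n i"] by auto
    have "w \<bullet> unit_vec n i = (A\<^sup>T *\<^sub>v w) \<bullet> x"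
      using transpose_vec_mult_scalar[OF A x(1) w] x(2) by simp
    also have "\<dots> = 0" using 0 x by simp
    finally show ?thesis using w i by simp
  qed
  then show ?thesis using w by (intro eq_vecI) auto
qed

lemma mat_surj_of_inj:
  fixes M :: "'a :: field mat"
  assumes M: "M \<in> carrier_mat N N"
    and inj: "\<And>w. w \<in> carrier_vec N \<Longrightarrow> M *\<^sub>v w = 0\<^sub>v N \<Longrightarrow> w = 0\<^sub>v N"
    and v: "v \<in> carrier_vec N"
  shows "\<exists>w \<in> carrier_vec N. M *\<^sub>v w = v"
proof -
  have "det M \<noteq> 0" using det_0_iff_vec_prod_zero_field[OF M] inj by blast
  then obtain B where B: "B \<in> carrier_mat N N" "M * B = 1\<^sub>m N"
    using det_non_zero_imp_unit[OF M, of "()"] by (auto simp: Units_def ring_mat_simps)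
  then have "M *\<^sub>v (B *\<^sub>v v) = v" using M v by (simp flip: assoc_mult_mat_vec)
  then show ?thesis using B v by (intro bexI[of _ "B *\<^sub>v v"]) auto
qed

lemma trans_inj_of_inj:
  fixes M :: "'a :: field mat"
  assumes M: "M \<in> carrier_mat N N"
    and inj: "\<And>w. w \<in> carrier_vec N \<Longrightarrow> M *\<^sub>v w = 0\<^sub>v N \<Longrightarrow> w = 0\<^sub>v N"
    and "w \<in> carrier_vec N" "M\<^sup>T *\<^sub>v w = 0\<^sub>v N"
  shows "w = 0\<^sub>v N"
proof -
  have "det M\<^sup>T \<noteq> 0"
    unfolding det_transpose[OF M] using det_0_iff_vec_prod_zero_field[OF M] inj by blast
  moreover have "M\<^sup>T \<in> carrier_mat N N" using M by simp
  ultimately show ?thesis using det_0_iff_vec_prod_zero_field[of "M\<^sup>T" N] assms(3,4) by blast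
qed

text \<open>The kernel has dimension two, so any two independent vectors in it span it. The proof avoids
  dimensions: the square matrix with columns the rows of \<open>A\<close> followed by \<open>y1\<close> and \<open>y2\<close> is
  injective, since row space and kernel are orthogonal. So every \<open>y\<close> decomposes into a row space part
  and a combination of \<open>y1\<close> and \<open>y2\<close>; for \<open>y\<close> in the kernel the row space part is orthogonal to
  itself.\<close>

lemma two_kernel_vectors_span:
  fixes A :: "real mat"
  assumes A: "A \<in> carrier_mat n (n + 2)" and r: "vec_space.rank n A = n"
    and y1: "y1 \<in> mat_kernel A" and y2: "y2 \<in> mat_kernel A" and y: "y \<in> mat_kernel A"
    and ij: "i < n + 2" "j < n + 2" "y1 $ i \<noteq> 0" "y1 $ j = 0" "y2 $ i = 0" "y2 $ j \<noteq> 0"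
  shows "\<exists>\<alpha> \<beta>. y = \<alpha> \<cdot>\<^sub>v y1 + \<beta> \<cdot>\<^sub>v y2"
proof -
  have c: "y1 \<in> carrier_vec (n + 2)" "y2 \<in> carrier_vec (n + 2)" "y \<in> carrier_vec (n + 2)"
    and ker: "A *\<^sub>v y1 = 0\<^sub>v n" "A *\<^sub>v y2 = 0\<^sub>v n" "A *\<^sub>v y = 0\<^sub>v n"
    using assms mat_kernelD[OF A] by auto
  define M where "M = mat (n + 2) (n + 2) (\<lambda>(k, l).
    if l < n then A $$ (l, k) else if l = n then y1 $ k else y2 $ k)"
  have M: "M \<in> carrier_mat (n + 2) (n + 2)" by (simp add: M_def)
  have Mw: "M *\<^sub>v w = A\<^sup>T *\<^sub>v vec n (\<lambda>l. w $ l) + (w $ n \<cdot>\<^sub>v y1 + w $ (n + 1) \<cdot>\<^sub>v y2)"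
    if "w \<in> carrier_vec (n + 2)" for w
    using that A c
    by (intro eq_vecI) (auto simp: M_def scalar_prod_def row_def col_def mult.commute)
  have perp: "(A\<^sup>T *\<^sub>v u) \<bullet> z = 0" if "u \<in> carrier_vec n" "z \<in> carrier_vec (n + 2)" "A *\<^sub>v z = 0\<^sub>v n" for u z
    using transpose_vec_mult_scalar[OF A that(2,1)] that by simp
  have zero: "A\<^sup>T *\<^sub>v u = 0\<^sub>v (n + 2)"
    if u: "u \<in> carrier_vec n" and eq: "A\<^sup>T *\<^sub>v u = z" and z: "z \<in> carrier_vec (n + 2)" "A *\<^sub>v z = 0\<^sub>v n" for u z
    using perp[OF u z] z(1) conjugate_square_eq_0_vec[OF z(1)] by (simp add: eq)
  have comb: "\<alpha> \<cdot>\<^sub>v y1 + \<beta> \<cdot>\<^sub>v y2 \<in> carrier_vec (n + 2)" "A *\<^sub>v (\<alpha> \<cdot>\<^sub>v y1 + \<beta> \<cdot>\<^sub>v y2) = 0\<^sub>v n" for \<alpha> \<beta>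
    using A c ker by (auto simp: mult_add_distrib_mat_vec[OF A] mult_mat_vec[OF A])
  have inj: "w = 0\<^sub>v (n + 2)" if w: "w \<in> carrier_vec (n + 2)" and Mw0: "M *\<^sub>v w = 0\<^sub>v (n + 2)" for w
  proof -
    let ?u = "vec n (\<lambda>l. w $ l)"
    let ?z = "w $ n \<cdot>\<^sub>v y1 + w $ (n + 1) \<cdot>\<^sub>v y2"
    have e: "(A\<^sup>T *\<^sub>v ?u) $ k + ?z $ k = 0" if "k < n + 2" for k
      using arg_cong[OF Mw0[unfolded Mw[OF w]], of "\<lambda>v. v $ k"] that A c by simp
    have "A\<^sup>T *\<^sub>v ?u = (- w $ n) \<cdot>\<^sub>v y1 + (- w $ (n + 1)) \<cdot>\<^sub>v y2"
    proof (rule eq_vecI)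
      fix k assume "k < dim_vec ((- w $ n) \<cdot>\<^sub>v y1 + (- w $ (n + 1)) \<cdot>\<^sub>v y2)"
      then have k: "k < n + 2" using c by simp
      then have "(A\<^sup>T *\<^sub>v ?u) $ k = - ?z $ k" using e[OF k] by linarith
      then show "(A\<^sup>T *\<^sub>v ?u) $ k = ((- w $ n) \<cdot>\<^sub>v y1 + (- w $ (n + 1)) \<cdot>\<^sub>v y2) $ k"
        using k c by simp
    qed (use A c in simp)
    then have u0: "A\<^sup>T *\<^sub>v ?u = 0\<^sub>v (n + 2)" using zero[OF _ _ comb, of ?u] by simp
    have "?u = 0\<^sub>v n" by (rule vec_space.trans_mult_vec_eq_0_of_rank[OF A r vec_carrier u0])
    then have wk: "w $ k = 0" if "k < n" for k
      using that by (metis index_vec index_zero_vec(1))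
    have "?z $ i = 0" "?z $ j = 0" using e[OF ij(1)] e[OF ij(2)] u0 ij(1,2) by simp_all
    then have "w $ n = 0" "w $ (n + 1) = 0" using ij c by simp_all
    then have "w $ k = 0" if "k < n + 2" for k
      using wk that by (cases "k < n"; cases "k = n"; cases "k = n + 1") simp_all
    then show ?thesis using w by (intro eq_vecI) simp_all
  qed
  obtain w where w: "w \<in> carrier_vec (n + 2)" "M *\<^sub>v w = y" using mat_surj_of_inj[OF M inj c(3)] by auto
  let ?u = "vec n (\<lambda>l. w $ l)"
  have "y $ k = (A\<^sup>T *\<^sub>v ?u) $ k + (w $ n \<cdot>\<^sub>v y1 + w $ (n + 1) \<cdot>\<^sub>v y2) $ k" if "k < n + 2" for k
    unfolding w(2)[symmetric] Mw[OF w(1)] using that c by simp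
  then have "A\<^sup>T *\<^sub>v ?u = y - (w $ n \<cdot>\<^sub>v y1 + w $ (n + 1) \<cdot>\<^sub>v y2)"
    using A c by (intro eq_vecI) simp_all
  then have u0: "A\<^sup>T *\<^sub>v ?u = 0\<^sub>v (n + 2)"
    by (rule zero[rotated]) (use A c comb ker in \<open>auto simp: mult_minus_distrib_mat_vec[OF A]\<close>)
  have "y = w $ n \<cdot>\<^sub>v y1 + w $ (n + 1) \<cdot>\<^sub>v y2"
    using Mw[OF w(1)] c unfolding w(2) u0 by simp
  then show ?thesis by blast
qed

text \<open>Adding \<open>b\<close> as a last row to \<open>C\<close> gives a square matrix \<open>M b\<close> that is injective, because \<open>b\<close> is
  not orthogonal to itself. So its transpose is bijective, and restricting it to vectors with last
  entry zero gives both claims.\<close>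

lemma row_space_orthogonal_kernel:
  fixes C :: "real mat"
  assumes C: "C \<in> carrier_mat m (m + 1)" and b: "b \<in> carrier_vec (m + 1)"
    and ker: "mat_kernel C = {c \<cdot>\<^sub>v b | c. True}"
  shows trans_inj_of_kernel_line: "\<And>w. w \<in> carrier_vec m \<Longrightarrow> C\<^sup>T *\<^sub>v w = 0\<^sub>v (m + 1) \<Longrightarrow> w = 0\<^sub>v m"
    and trans_range_of_kernel_line:
      "\<And>v. v \<in> carrier_vec (m + 1) \<Longrightarrow> v \<bullet> b = 0 \<Longrightarrow> \<exists>w \<in> carrier_vec m. C\<^sup>T *\<^sub>v w = v"
proof -
  define M where "M d = mat (m + 1) (m + 1) (\<lambda>(i, j). if i < m then C $$ (i, j) else d $ j)" for d
  have M: "M d \<in> carrier_mat (m + 1) (m + 1)" for d by (simp add: M_def)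
  have Mv: "(M d *\<^sub>v v) $ i = (if i < m then (C *\<^sub>v v) $ i else d \<bullet> v)"
    if "v \<in> carrier_vec (m + 1)" "d \<in> carrier_vec (m + 1)" "i < m + 1" for d v i
    using that C by (auto simp: M_def scalar_prod_def row_def)
  have MTw: "(M d)\<^sup>T *\<^sub>v w = C\<^sup>T *\<^sub>v vec m (\<lambda>l. w $ l) + w $ m \<cdot>\<^sub>v d"
    if "w \<in> carrier_vec (m + 1)" "d \<in> carrier_vec (m + 1)" for w d
    using that C by (intro eq_vecI) (auto simp: M_def scalar_prod_def row_def col_def mult.commute)
  have Mker: "C *\<^sub>v v = 0\<^sub>v m"
    if v: "v \<in> carrier_vec (m + 1)" "d \<in> carrier_vec (m + 1)" "M d *\<^sub>v v = 0\<^sub>v (m + 1)" for v d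
  proof (rule eq_vecI)
    show "(C *\<^sub>v v) $ i = 0\<^sub>v m $ i" if "i < dim_vec (0\<^sub>v m)" for i
      using Mv[OF v(1,2), of i] that unfolding v(3) by simp
  qed (use C in simp)
  have bker: "C *\<^sub>v b = 0\<^sub>v m"
    using mat_kernelD(2)[OF C, of b] ker by (metis (mono_tags, lifting) mem_Collect_eq one_smult_vec)
  \<comment> \<open>A matrix with fewer rows than columns has a nontrivial kernel: completed by a zero row it becomes
    square, and its transpose kills the last unit vector.\<close>
  have b0: "b \<noteq> 0\<^sub>v (m + 1)"
  proof
    assume "b = 0\<^sub>v (m + 1)"
    have h1: "v = 0\<^sub>v (m + 1)" if v: "v \<in> carrier_vec (m + 1)" "M (0\<^sub>v (m + 1)) *\<^sub>v v = 0\<^sub>v (m + 1)" for v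
    proof -
      have "v \<in> mat_kernel C" using mat_kernelI[OF C v(1) Mker[OF v(1) zero_carrier_vec v(2)]] .
      then show ?thesis using ker \<open>b = _\<close> by auto
    qed
    have h2: "(M (0\<^sub>v (m + 1)))\<^sup>T *\<^sub>v unit_vec (m + 1) m = 0\<^sub>v (m + 1)"
      unfolding MTw[OF unit_vec_carrier zero_carrier_vec]
      using C by (intro eq_vecI) (auto simp: scalar_prod_def)
    have "unit_vec (m + 1) m = (0\<^sub>v (m + 1) :: real vec)"
      by (rule trans_inj_of_inj[OF M h1 unit_vec_carrier h2])
    from arg_cong[OF this, of "\<lambda>v. v $ m"] show False by simp
  qed
  then have bb: "b \<bullet> b \<noteq> 0" using b conjugate_square_eq_0_vec[OF b] by simp
  have inj: "v = 0\<^sub>v (m + 1)" if v: "v \<in> carrier_vec (m + 1)" "M b *\<^sub>v v = 0\<^sub>v (m + 1)" for v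
  proof -
    have "v \<in> mat_kernel C" using mat_kernelI[OF C v(1) Mker[OF v(1) b v(2)]] .
    then obtain c where c: "v = c \<cdot>\<^sub>v b" using ker by auto
    have "b \<bullet> v = 0" using Mv[OF v(1) b, of m] unfolding v(2) by simp
    then have "c = 0" using c bb b by simp
    then show ?thesis using c b by (intro eq_vecI) auto
  qed
  have MT_inj: "w = 0\<^sub>v (m + 1)" if "w \<in> carrier_vec (m + 1)" "(M b)\<^sup>T *\<^sub>v w = 0\<^sub>v (m + 1)" for w
    by (rule trans_inj_of_inj[OF M inj that])
  show "w = 0\<^sub>v m" if w: "w \<in> carrier_vec m" and 0: "C\<^sup>T *\<^sub>v w = 0\<^sub>v (m + 1)" for w
  proof -
    let ?w = "vec (m + 1) (\<lambda>l. if l < m then w $ l else 0)"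
    have "vec m (\<lambda>l. ?w $ l) = w" using w by (intro eq_vecI) auto
    then have MT0: "(M b)\<^sup>T *\<^sub>v ?w = 0\<^sub>v (m + 1)"
      unfolding MTw[OF vec_carrier b] using b 0 by auto
    have w0: "?w = 0\<^sub>v (m + 1)" by (rule MT_inj[OF vec_carrier MT0])
    have "w $ l = 0" if "l < m" for l
    proof -
      have "w $ l = ?w $ l" using that by simp
      also have "\<dots> = 0" unfolding w0 using that by simp
      finally show ?thesis .
    qed
    then show ?thesis using w by (intro eq_vecI) auto
  qed
  show "\<exists>w \<in> carrier_vec m. C\<^sup>T *\<^sub>v w = v" if v: "v \<in> carrier_vec (m + 1)" and vb: "v \<bullet> b = 0" for v
  proof -
    have MT: "(M b)\<^sup>T \<in> carrier_mat (m + 1) (m + 1)" using M by simp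
    have "\<exists>w \<in> carrier_vec (m + 1). (M b)\<^sup>T *\<^sub>v w = v"
      by (rule mat_surj_of_inj[OF MT MT_inj v])
    then obtain w where w: "w \<in> carrier_vec (m + 1)" "(M b)\<^sup>T *\<^sub>v w = v" by blast
    let ?u = "vec m (\<lambda>l. w $ l)"
    have "(C\<^sup>T *\<^sub>v ?u + w $ m \<cdot>\<^sub>v b) \<bullet> b = 0" using vb MTw[OF w(1) b] w(2) by simp
    moreover have "(C\<^sup>T *\<^sub>v ?u) \<bullet> b = 0" using transpose_vec_mult_scalar[OF C b, of ?u] bker by simp
    ultimately have "w $ m * (b \<bullet> b) = 0" using C b by (simp add: add_scalar_prod_distrib[of _ "m + 1"])
    then have "w $ m = 0" using bb by simp
    then have "C\<^sup>T *\<^sub>v ?u = v" using MTw[OF w(1) b] w(2) b C by auto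
    then show ?thesis by (intro bexI[of _ ?u]) auto
  qed
qed

section \<open>Positive solutions as zeros of a univariate function\<close>

text \<open>With \<open>y = \<alpha> y1 + \<beta> y2\<close>, the coordinates in which only one of the two generators is
  nonzero force \<open>\<alpha>\<close> and \<open>\<beta>\<close> to be positive, and \<open>t = (\<alpha> - \<beta>) / (\<alpha> + \<beta>)\<close>.\<close>

lemma positive_kernel_param:
  fixes A :: "real mat"
  assumes A: "A \<in> carrier_mat n (n + 2)" and r: "vec_space.rank n A = n"
    and y1: "y1 \<in> mat_kernel A" and y2: "y2 \<in> mat_kernel A"
    and ij: "i < n + 2" "j < n + 2" "0 < y1 $ i" "y1 $ j = 0" "y2 $ i = 0" "0 < y2 $ j"
    and y: "y \<in> mat_kernel A" "\<And>k. k < n + 2 \<Longrightarrow> 0 < y $ k"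
  shows "\<exists>\<mu>>0. \<exists>t. -1 < t \<and> t < 1 \<and>
    (\<forall>k<n + 2. y $ k = \<mu> * (y1 $ k + y2 $ k + t * (y1 $ k - y2 $ k)))"
proof -
  have c: "y1 \<in> carrier_vec (n + 2)" "y2 \<in> carrier_vec (n + 2)"
    using y1 y2 mat_kernelD(1)[OF A] by auto
  obtain \<alpha> \<beta> where ab: "y = \<alpha> \<cdot>\<^sub>v y1 + \<beta> \<cdot>\<^sub>v y2"
    using two_kernel_vectors_span[OF A r y1 y2 y(1) ij(1,2)] ij by auto
  have "0 < \<alpha> * y1 $ i" "0 < \<beta> * y2 $ j"
    using y(2)[OF ij(1)] y(2)[OF ij(2)] ij c unfolding ab by simp_all
  then have pos: "0 < \<alpha>" "0 < \<beta>" using ij by (simp_all add: zero_less_mult_iff)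
  have "y $ k = (\<alpha> + \<beta>) / 2 * (y1 $ k + y2 $ k + (\<alpha> - \<beta>) / (\<alpha> + \<beta>) * (y1 $ k - y2 $ k))"
    if "k < n + 2" for k
    using that c pos unfolding ab by (simp add: field_simps)
  then show ?thesis using pos
    by (intro exI[of _ "(\<alpha> + \<beta>) / 2"] conjI exI[of _ "(\<alpha> - \<beta>) / (\<alpha> + \<beta>)"]) (auto simp: field_simps)
qed

lemma append_ones_carrier:
  "B \<in> carrier_mat n N \<Longrightarrow> append_ones B \<in> carrier_mat (n + 1) N"
  unfolding append_ones_def by (intro carrier_append_rows) (auto simp: mat_of_row_def)

lemma index_trans_append_ones:
  assumes B: "B \<in> carrier_mat n N" and w: "w \<in> carrier_vec (n + 1)" and k: "k < N"
  shows "((append_ones B)\<^sup>T *\<^sub>v w) $ k = (\<Sum>i<n. B $$ (i, k) * w $ i) + w $ n"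
proof -
  have C: "append_ones B \<in> carrier_mat (n + 1) N" using append_ones_carrier[OF B] .
  have e: "append_ones B $$ (i, k) = (if i < n then B $$ (i, k) else 1)" if "i < n + 1" for i
    using that B k by (auto simp: append_ones_def append_rows_def mat_of_row_def)
  have "((append_ones B)\<^sup>T *\<^sub>v w) $ k = (\<Sum>i<n + 1. append_ones B $$ (i, k) * w $ i)"
    using C w k by (simp add: scalar_prod_def atLeast0LessThan)
  then show ?thesis using e by simp
qed

lemma sum_eq_0_of_append_ones_kernel:
  assumes B: "B \<in> carrier_mat n N" and b: "b \<in> mat_kernel (append_ones B)"
  shows "(\<Sum>k<N. b $ k) = 0"
proof -
  have C: "append_ones B \<in> carrier_mat (n + 1) N" using append_ones_carrier[OF B] .
  have "(append_ones B *\<^sub>v b) $ n = (\<Sum>k<N. append_ones B $$ (n, k) * b $ k)"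
    using C mat_kernelD(1)[OF C b] by (simp add: scalar_prod_def atLeast0LessThan)
  also have "\<dots> = (\<Sum>k<N. b $ k)"
    using B by (intro sum.cong) (auto simp: append_ones_def append_rows_def mat_of_row_def)
  finally show ?thesis using mat_kernelD(2)[OF C b] by simp
qed

lemma monomials_exp:
  assumes B: "B \<in> carrier_mat n N" and k: "k < N"
  shows "monomials (vec n (\<lambda>i. exp (w i))) B $ k = exp (\<Sum>i<n. B $$ (i, k) * w i)"
  using B k by (simp add: monomials_def powr_def exp_sum)

text \<open>The first \<open>n\<close> entries of \<open>w\<close> are the logarithms of the solution; the last one is the negative
  logarithm of the factor \<open>\<mu>\<close> by which the monomials differ from \<open>e \<circ> (1 + t q)\<close>.\<close>

lemma positive_solutions_iff_log:
  fixes A B :: "real mat" and e :: "nat \<Rightarrow> real"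
  assumes A: "A \<in> carrier_mat n (n + 2)" and B: "B \<in> carrier_mat n (n + 2)"
    and pos: "\<And>t k. -1 < t \<Longrightarrow> t < 1 \<Longrightarrow> k < n + 2 \<Longrightarrow> 0 < e k * (1 + t * q k)"
    and ker: "\<And>y. y \<in> carrier_vec (n + 2) \<Longrightarrow> (\<And>k. k < n + 2 \<Longrightarrow> 0 < y $ k) \<Longrightarrow>
      A *\<^sub>v y = 0\<^sub>v n \<longleftrightarrow> (\<exists>\<mu>>0. \<exists>t. -1 < t \<and> t < 1 \<and> (\<forall>k<n + 2. y $ k = \<mu> * (e k * (1 + t * q k))))"
  shows "x \<in> positive_solutions A B \<longleftrightarrow>
    (\<exists>t w. -1 < t \<and> t < 1 \<and> w \<in> carrier_vec (n + 1) \<and>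
      (append_ones B)\<^sup>T *\<^sub>v w = vec (n + 2) (\<lambda>k. ln (e k * (1 + t * q k))) \<and>
      x = vec n (\<lambda>i. exp (w $ i)))"
    (is "_ \<longleftrightarrow> ?R")
proof
  assume "x \<in> positive_solutions A B"
  then have x: "x \<in> carrier_vec n" "\<And>i. i < n \<Longrightarrow> 0 < x $ i" "A *\<^sub>v monomials x B = 0\<^sub>v n"
    using A B by (auto simp: positive_solutions_def)
  have xe: "x = vec n (\<lambda>i. exp (ln (x $ i)))" using x by (intro eq_vecI) auto
  have m: "monomials x B $ k = exp (\<Sum>i<n. B $$ (i, k) * ln (x $ i))" if "k < n + 2" for k
    using monomials_exp[OF B that] xe by metis
  have mc: "monomials x B \<in> carrier_vec (n + 2)" using B by (simp add: monomials_def)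
  obtain \<mu> t where lt: "0 < \<mu>" "-1 < t" "t < 1"
    and ml: "\<And>k. k < n + 2 \<Longrightarrow> monomials x B $ k = \<mu> * (e k * (1 + t * q k))"
    using ker[OF mc] m x(3) by auto
  define w where "w = vec (n + 1) (\<lambda>i. if i < n then ln (x $ i) else - ln \<mu>)"
  have w: "w \<in> carrier_vec (n + 1)" by (simp add: w_def)
  have "(append_ones B)\<^sup>T *\<^sub>v w = vec (n + 2) (\<lambda>k. ln (e k * (1 + t * q k)))"
  proof (rule eq_vecI)
    fix k assume "k < dim_vec (vec (n + 2) (\<lambda>k. ln (e k * (1 + t * q k))))"
    then have k: "k < n + 2" by simp
    have "(\<Sum>i<n. B $$ (i, k) * ln (x $ i)) = ln (monomials x B $ k)" unfolding m[OF k] by simp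
    also have "\<dots> = ln \<mu> + ln (e k * (1 + t * q k))"
      unfolding ml[OF k] using lt pos[OF lt(2,3) k] by (simp add: ln_mult_pos)
    finally show "((append_ones B)\<^sup>T *\<^sub>v w) $ k = vec (n + 2) (\<lambda>k. ln (e k * (1 + t * q k))) $ k"
      unfolding index_trans_append_ones[OF B w k] using k by (simp add: w_def)
  qed (use append_ones_carrier[OF B] in simp)
  moreover have "vec n (\<lambda>i. exp (ln (x $ i))) = vec n (\<lambda>i. exp (w $ i))"
    by (intro eq_vecI) (simp_all add: w_def)
  then have "x = vec n (\<lambda>i. exp (w $ i))" using xe by (rule trans[rotated])
  ultimately show ?R using lt w by blast
next
  assume ?R
  then obtain t w where t: "-1 < t" "t < 1" and w: "w \<in> carrier_vec (n + 1)"
    and Cw: "(append_ones B)\<^sup>T *\<^sub>v w = vec (n + 2) (\<lambda>k. ln (e k * (1 + t * q k)))"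
    and x: "x = vec n (\<lambda>i. exp (w $ i))" by blast
  have m: "monomials x B $ k = exp (- w $ n) * (e k * (1 + t * q k))" if k: "k < n + 2" for k
  proof -
    have "(\<Sum>i<n. B $$ (i, k) * w $ i) = - w $ n + ln (e k * (1 + t * q k))"
      using index_trans_append_ones[OF B w k] Cw k by simp
    then have "monomials x B $ k = exp (- w $ n + ln (e k * (1 + t * q k)))"
      unfolding x monomials_exp[OF B k] by (rule arg_cong)
    then show ?thesis unfolding exp_add using pos[OF t k] by simp
  qed
  have "monomials x B \<in> carrier_vec (n + 2)" using B by (simp add: monomials_def)
  then have "A *\<^sub>v monomials x B = 0\<^sub>v n"
    using ker[of "monomials x B"] m pos t by (metis exp_gt_zero mult_pos_pos)
  then show "x \<in> positive_solutions A B" using A B by (simp add: positive_solutions_def x)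
qed

text \<open>The parameter \<open>t\<close> of a solution determines \<open>w\<close> and thus the solution, and it is a zero of
  \<open>g t = lg t \<bullet> b\<close>, whose derivative is \<open>D\<close>. If \<open>D\<close> is zero and some solution exists, then
  \<open>g\<close> vanishes identically, and every \<open>t\<close> belongs to some solution because the range of the
  transpose is the orthogonal complement of \<open>b\<close>; different \<open>t\<close> then give infinitely many
  solutions.\<close>

lemma card_positive_solutions_le_card_zeros:
  fixes n :: nat and B :: "real mat" and e :: "nat \<Rightarrow> real" and q b :: "real vec"
  defines "lg \<equiv> \<lambda>t. vec (n + 2) (\<lambda>k. ln (e k * (1 + t * q $ k)))"
    and "D \<equiv> \<lambda>t. \<Sum>k<n + 2. b $ k * (q $ k / (1 + t * q $ k))"
  assumes B: "B \<in> carrier_mat n (n + 2)" and b: "b \<in> carrier_vec (n + 2)"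
    and ker: "mat_kernel (append_ones B) = {c \<cdot>\<^sub>v b | c. True}"
    and e: "\<And>k. k < n + 2 \<Longrightarrow> 0 < e k"
    and q: "\<And>k. k < n + 2 \<Longrightarrow> -1 \<le> q $ k \<and> q $ k \<le> 1" "q $ 0 = 1" "q $ (n + 1) = -1"
    and sol: "\<And>x. x \<in> S \<longleftrightarrow> (\<exists>t w. -1 < t \<and> t < 1 \<and> w \<in> carrier_vec (n + 1) \<and>
      (append_ones B)\<^sup>T *\<^sub>v w = lg t \<and> x = vec n (\<lambda>i. exp (w $ i)))"
    and fin: "finite S"
  shows "finite {t. -1 < t \<and> t < 1 \<and> D t = 0} \<Longrightarrow> card S \<le> Suc (card {t. -1 < t \<and> t < 1 \<and> D t = 0})"
    and "(\<And>t. -1 < t \<Longrightarrow> t < 1 \<Longrightarrow> D t = 0) \<Longrightarrow> S = {}"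
proof -
  have C: "append_ones B \<in> carrier_mat (n + 1) (n + 1 + 1)" using append_ones_carrier[OF B] by simp
  have b': "b \<in> carrier_vec (n + 1 + 1)" using b by simp
  have CT: "(append_ones B)\<^sup>T \<in> carrier_mat (n + 2) (n + 1)" using C by simp
  note C_inj = trans_inj_of_kernel_line[OF C b' ker]
  note C_range = trans_range_of_kernel_line[OF C b' ker]
  have bker: "append_ones B *\<^sub>v b = 0\<^sub>v (n + 1)"
    using mat_kernelD(2)[OF C, of b] ker by (metis (mono_tags, lifting) mem_Collect_eq one_smult_vec)
  define g where "g t = lg t \<bullet> b" for t
  have pos: "0 < 1 + t * q $ k" if "-1 < t" "t < 1" "k < n + 2" for t k
    using one_plus_mult_pos[of t "q $ k"] q that by auto
  have g: "g t = (\<Sum>k<n + 2. b $ k * ln (e k * (1 + t * q $ k)))" for t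
    using b by (simp add: g_def lg_def scalar_prod_def atLeast0LessThan mult.commute)
  have der: "(g has_real_derivative D t) (at t)" if t: "-1 < t" "t < 1" for t
  proof -
    have "((\<lambda>t. b $ k * ln (e k * (1 + t * q $ k))) has_real_derivative b $ k * (q $ k / (1 + t * q $ k))) (at t)"
      if "k < n + 2" for k
      using e[OF that] pos[OF t that] by (auto intro!: derivative_eq_intros simp: divide_simps)
    then show ?thesis unfolding g[abs_def] D_def by (intro DERIV_sum) auto
  qed
  have g0: "g t = 0" if "w \<in> carrier_vec (n + 1)" "(append_ones B)\<^sup>T *\<^sub>v w = lg t" for t w
    using transpose_vec_mult_scalar[OF C b' that(1)] bker that by (simp add: g_def)
  obtain \<tau> W where tW: "\<And>x. x \<in> S \<Longrightarrow> -1 < \<tau> x \<and> \<tau> x < 1 \<and> W x \<in> carrier_vec (n + 1) \<and>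
      (append_ones B)\<^sup>T *\<^sub>v W x = lg (\<tau> x) \<and> x = vec n (\<lambda>i. exp (W x $ i))"
    using sol by metis
  then have \<tau>: "-1 < \<tau> x" "\<tau> x < 1" and W: "W x \<in> carrier_vec (n + 1)"
    and CW: "(append_ones B)\<^sup>T *\<^sub>v W x = lg (\<tau> x)" and xW: "x = vec n (\<lambda>i. exp (W x $ i))"
    if "x \<in> S" for x using that by blast+
  have C_inj2: "w = w'" if "w \<in> carrier_vec (n + 1)" "w' \<in> carrier_vec (n + 1)"
    "(append_ones B)\<^sup>T *\<^sub>v w = (append_ones B)\<^sup>T *\<^sub>v w'" for w w'
  proof -
    have "(append_ones B)\<^sup>T *\<^sub>v (w - w') = 0\<^sub>v (n + 1 + 1)"
      using mult_minus_distrib_mat_vec[OF CT that(1,2)] that(3) CT that(2) by simp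
    then have d: "w - w' = 0\<^sub>v (n + 1)" using C_inj[of "w - w'"] that by simp
    show ?thesis
    proof (rule eq_vecI)
      fix i assume "i < dim_vec w'"
      then have i: "i < n + 1" using that(2) by simp
      then have "(w - w') $ i = 0" unfolding d by simp
      then show "w $ i = w' $ i" using i that(1,2) by simp
    qed (use that in simp)
  qed
  have \<tau>_inj: "inj_on \<tau> S"
  proof (rule inj_onI)
    fix x x' assume xx: "x \<in> S" "x' \<in> S" "\<tau> x = \<tau> x'"
    have "W x = W x'"
      by (rule C_inj2[OF W[OF xx(1)] W[OF xx(2)]]) (simp only: CW[OF xx(1)] CW[OF xx(2)] xx(3))
    then show "x = x'" using xW[OF xx(1)] xW[OF xx(2)] by metis
  qed
  have \<tau>_zero: "\<tau> ` S \<subseteq> {t. -1 < t \<and> t < 1 \<and> g t = 0}" using \<tau> g0 W CW by blast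
  show "card S \<le> Suc (card {t. -1 < t \<and> t < 1 \<and> D t = 0})" if "finite {t. -1 < t \<and> t < 1 \<and> D t = 0}"
  proof -
    have "finite {t. -1 < t \<and> t < 1 \<and> g t = 0}"
      by (rule finite_zeros_Rolle(1)[OF der that])
    then have "card S \<le> card {t. -1 < t \<and> t < 1 \<and> g t = 0}"
      by (rule card_inj_on_le[OF \<tau>_inj \<tau>_zero])
    also have "\<dots> \<le> Suc (card {t. -1 < t \<and> t < 1 \<and> D t = 0})"
      by (rule finite_zeros_Rolle(2)[OF der that])
    finally show ?thesis .
  qed
  show "S = {}" if D0: "\<And>t. -1 < t \<Longrightarrow> t < 1 \<Longrightarrow> D t = 0"
  proof (rule ccontr)
    assume "S \<noteq> {}"
    then obtain t0 where t0: "-1 < t0" "t0 < 1" "g t0 = 0" using \<tau>_zero by blast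
    have "\<exists>c. \<forall>t\<in>{-1<..<1}. g t = c"
    proof (rule has_field_derivative_zero_constant)
      fix t :: real assume "t \<in> {-1<..<1}"
      then show "(g has_field_derivative 0) (at t within {-1<..<1})"
        using der[of t] D0[of t] by (auto intro: has_field_derivative_at_within)
    qed simp
    then have g_zero: "g t = 0" if "t \<in> {-1<..<1}" for t using that t0 by auto
    have "\<exists>w \<in> carrier_vec (n + 1). (append_ones B)\<^sup>T *\<^sub>v w = lg t" if t: "t \<in> {-1<..<1}" for t
      using C_range[of "lg t"] g_zero[OF t] by (simp add: g_def lg_def)
    then obtain w where w: "\<And>t. t \<in> {-1<..<1} \<Longrightarrow> w t \<in> carrier_vec (n + 1) \<and> (append_ones B)\<^sup>T *\<^sub>v w t = lg t"
      by metis
    define \<xi> where "\<xi> t = vec n (\<lambda>i. exp (w t $ i))" for t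
    have wl: "(\<Sum>i<n. B $$ (i, k) * w t $ i) + w t $ n = ln (e k) + ln (1 + t * q $ k)"
      if "t \<in> {-1<..<1}" "k < n + 2" for t k
      using index_trans_append_ones[OF B, of "w t" k] w[OF that(1)] that e[OF that(2)] pos[of t k]
      by (simp add: lg_def ln_mult_pos)
    have "inj_on \<xi> {-1<..<1}"
    proof (rule linorder_inj_onI)
      fix t t' :: real assume tt: "t < t'" "t \<in> {-1<..<1}" "t' \<in> {-1<..<1}"
      show "\<xi> t \<noteq> \<xi> t'"
      proof
        assume eq: "\<xi> t = \<xi> t'"
        have "w t $ i = w t' $ i" if "i < n" for i
          using arg_cong[OF eq, of "\<lambda>v. v $ i"] that by (simp add: \<xi>_def)
        then have "ln (1 + t * q $ k) - ln (1 + t' * q $ k) = w t $ n - w t' $ n" if "k < n + 2" for k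
          using wl[OF tt(2) that] wl[OF tt(3) that] by simp
        \<comment> \<open>The difference is the same in all coordinates, but negative in the first and positive in
          the last one.\<close>
        from this[of 0] this[of "n + 1"]
        have "ln (1 + t) - ln (1 + t') = ln (1 - t) - ln (1 - t')" using q by simp
        moreover have "ln (1 + t) < ln (1 + t')" "ln (1 - t') < ln (1 - t)" using tt by simp_all
        ultimately show False by linarith
      qed
    qed auto
    moreover have "\<xi> t \<in> S" if "t \<in> {-1<..<1}" for t
      unfolding sol \<xi>_def using w[OF that] that by (intro exI[of _ t] exI[of _ "w t"]) simp
    then have "\<xi> ` {-1<..<1} \<subseteq> S" by blast
    ultimately have "finite {-1<..<(1::real)}" using fin inj_on_finite by blast
    then show False using infinite_Ioo[of "-1" "1 :: real"] by simp
  qed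
qed

section \<open>The polynomial and its zeros\<close>

lemma degree_trinomial_poly_le: "degree (trinomial_poly n b q) \<le> n"
  unfolding trinomial_poly_def
proof (rule degree_sum_le)
  fix i assume i: "i \<in> {1..n + 1}"
  let ?J = "{..<n + 2} - {i - 1, i}"
  have "card ?J = n" using i by (subst card_Diff_subset) auto
  have "degree (Polynomial.smult (partial_sum b i * (q $ i - q $ (i - 1))) (\<Prod>j\<in>?J. [:1, q $ j:])) \<le> degree (\<Prod>j\<in>?J. [:1, q $ j:])"
    by (rule degree_smult_le)
  also have "\<dots> \<le> (\<Sum>j\<in>?J. degree [:1, q $ j:])" using degree_prod_sum_le[of ?J "\<lambda>j. [:1, q $ j:]"] by (simp add: o_def)
  also have "\<dots> \<le> (\<Sum>j\<in>?J. 1)" by (intro sum_mono) simp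
  also have "\<dots> = n" using \<open>card ?J = n\<close> by simp
  finally show "degree (Polynomial.smult (partial_sum b i * (q $ i - q $ (i - 1))) (\<Prod>j\<in>?J. [:1, q $ j:])) \<le> n" .
qed simp

text \<open>Summation by parts replaces \<open>b\<close> by its partial sums and each summand by the difference
  \<open>q\<^sub>i / (1 + t q\<^sub>i) - q\<^sub>i\<^sub>+\<^sub>1 / (1 + t q\<^sub>i\<^sub>+\<^sub>1)\<close>, which simplifies to
  \<open>(q\<^sub>i - q\<^sub>i\<^sub>+\<^sub>1) / ((1 + t q\<^sub>i) (1 + t q\<^sub>i\<^sub>+\<^sub>1))\<close>.\<close>

lemma poly_trinomial_poly:
  assumes nz: "\<And>j. j < n + 2 \<Longrightarrow> 1 + t * q $ j \<noteq> 0"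
    and b: "(\<Sum>j<n + 2. b $ j) = 0"
  shows "poly (trinomial_poly n b q) t =
    - (\<Sum>j<n + 2. b $ j * (q $ j / (1 + t * q $ j))) * (\<Prod>j<n + 2. 1 + t * q $ j)"
proof -
  let ?u = "\<lambda>j. q $ j / (1 + t * q $ j)" and ?P = "\<Prod>j<n + 2. 1 + t * q $ j"
  have term_eq: "(q $ Suc i - q $ i) * (\<Prod>j\<in>{..<n + 2} - {i, Suc i}. 1 + t * q $ j) = - (?u i - ?u (Suc i)) * ?P"
    if i: "i < n + 1" for i
  proof -
    have "?P = (1 + t * q $ i) * (\<Prod>j\<in>{..<n + 2} - {i}. 1 + t * q $ j)"
      by (rule prod.remove) (use i in auto)
    also have "(\<Prod>j\<in>{..<n + 2} - {i}. 1 + t * q $ j)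
      = (1 + t * q $ Suc i) * (\<Prod>j\<in>{..<n + 2} - {i} - {Suc i}. 1 + t * q $ j)"
      by (rule prod.remove) (use i in auto)
    also have "{..<n + 2} - {i} - {Suc i} = {..<n + 2} - {i, Suc i}" by auto
    finally have P: "?P = (1 + t * q $ i) * ((1 + t * q $ Suc i) * (\<Prod>j\<in>{..<n + 2} - {i, Suc i}. 1 + t * q $ j))" .
    have alg: "(y - x) * R = - (x / (1 + t * x) - y / (1 + t * y)) * ((1 + t * x) * ((1 + t * y) * R))"
      if "1 + t * x \<noteq> 0" "1 + t * y \<noteq> 0" for x y R
      using that by (simp add: divide_simps) (simp add: algebra_simps)
    show ?thesis unfolding P by (rule alg) (use nz i in auto)
  qed
  have "poly (trinomial_poly n b q) t =
    (\<Sum>i = 1..n + 1. partial_sum b i * (q $ i - q $ (i - 1)) * (\<Prod>j\<in>{..<n + 2} - {i - 1, i}. 1 + t * q $ j))"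
    by (simp add: trinomial_poly_def poly_sum poly_prod mult_ac)
  also have "\<dots> = (\<Sum>i<n + 1. partial_sum b (Suc i) * ((q $ Suc i - q $ i) * (\<Prod>j\<in>{..<n + 2} - {i, Suc i}. 1 + t * q $ j)))"
    unfolding One_nat_def sum.atLeast1_atMost_eq by (simp add: mult_ac)
  also have "\<dots> = (\<Sum>i<n + 1. partial_sum b (Suc i) * (- (?u i - ?u (Suc i)) * ?P))"
    by (intro sum.cong refl) (simp only: term_eq lessThan_iff)
  also have "\<dots> = - (\<Sum>i<n + 1. partial_sum b (Suc i) * (?u i - ?u (Suc i))) * ?P"
    by (simp only: sum_distrib_right sum_negf mult_minus_left mult_minus_right mult.assoc)
  also have "(\<Sum>i<n + 1. partial_sum b (Suc i) * (?u i - ?u (Suc i))) = (\<Sum>j<n + 2. b $ j * ?u j)"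
    using sum_by_parts[of "\<lambda>j. b $ j" ?u "n + 1"] b by (simp add: partial_sum_def)
  finally show ?thesis .
qed

lemma poly_trinomial_poly_eq_0_iff:
  assumes q: "\<And>j. j < n + 2 \<Longrightarrow> -1 \<le> q $ j \<and> q $ j \<le> 1" and t: "-1 < t" "t < 1"
    and b: "(\<Sum>j<n + 2. b $ j) = 0"
  shows "poly (trinomial_poly n b q) t = 0 \<longleftrightarrow> (\<Sum>j<n + 2. b $ j * (q $ j / (1 + t * q $ j))) = 0"
proof -
  have nz: "1 + t * q $ j \<noteq> 0" if "j < n + 2" for j
    using one_plus_mult_pos[OF t, of "q $ j"] q[OF that] by simp
  then have "(\<Prod>j<n + 2. 1 + t * q $ j) \<noteq> 0"
    unfolding prod_zero_iff[OF finite_lessThan] by blast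
  moreover have eq: "poly (trinomial_poly n b q) t =
    - (\<Sum>j<n + 2. b $ j * (q $ j / (1 + t * q $ j))) * (\<Prod>j<n + 2. 1 + t * q $ j)"
    by (rule poly_trinomial_poly[OF nz b])
  ultimately show ?thesis unfolding eq mult_eq_0_iff neg_equal_0_iff_equal by blast
qed

text \<open>The hypothesis \<open>group\<close> says that weights \<open>\<beta>\<close> at the points \<open>x\<close> and weights \<open>b\<close> at the
  points \<open>q\<close> define the same discrete signed measure. Only this measure enters the function with
  the zeros of the polynomial, so any ordered grouping of equal points gives a bound.\<close>

lemma num_zeros_trinomial_poly_le_sgnvar:
  fixes \<beta> x :: "nat \<Rightarrow> real"
  assumes q: "\<And>j. j < n + 2 \<Longrightarrow> -1 \<le> q $ j \<and> q $ j \<le> 1"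
    and b: "(\<Sum>j<n + 2. b $ j) = 0"
    and group: "\<And>u. (\<Sum>l<k. \<beta> l * u (x l)) = (\<Sum>j<n + 2. b $ j * u (q $ j))"
    and x: "\<And>i j. i \<le> j \<Longrightarrow> j < k \<Longrightarrow> x j \<le> x i" "\<And>i. i < k \<Longrightarrow> -1 \<le> x i \<and> x i \<le> 1"
  shows "num_zeros (trinomial_poly n b q) \<le> sgnvar (map (\<lambda>i. \<Sum>j<i. \<beta> j) [1..<k])"
proof (cases "trinomial_poly n b q = 0")
  case False
  let ?p = "trinomial_poly n b q"
  let ?D = "\<lambda>t. \<Sum>l<k. \<beta> l * (x l / (1 + t * x l))"
  have zero_iff: "poly ?p t = 0 \<longleftrightarrow> ?D t = 0" if t: "-1 < t" "t < 1" for t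
    unfolding group[of "\<lambda>z. z / (1 + t * z)"] by (rule poly_trinomial_poly_eq_0_iff[OF q t b])
  have "infinite ({-1<..<1} - {t. poly ?p t = 0})"
    using poly_roots_finite[OF False] by simp
  then obtain t0 where "t0 \<in> {-1<..<1} - {t. poly ?p t = 0}" by (metis ex_in_conv finite.emptyI)
  then have t0: "-1 < t0" "t0 < 1" "?D t0 \<noteq> 0" using zero_iff by auto
  have "(\<Sum>l<k. \<beta> l) = 0" using group[of "\<lambda>_. 1"] b by simp
  from card_zeros_le_sgnvar[OF x this t0] show ?thesis
    using False zero_iff by (simp add: num_zeros_def cong: conj_cong)
qed (simp add: num_zeros_def)

lemma num_zeros_trinomial_poly_le_sgnvar_classes:
  assumes dim: "dim_vec q = n + 2"
    and mono: "\<And>i j. i \<le> j \<Longrightarrow> j < n + 2 \<Longrightarrow> q $ j \<le> q $ i"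
    and q: "\<And>j. j < n + 2 \<Longrightarrow> -1 \<le> q $ j \<and> q $ j \<le> 1"
    and b: "(\<Sum>j<n + 2. b $ j) = 0"
    and I: "ordered_classes q k I"
  shows "num_zeros (trinomial_poly n b q) \<le> sgnvar (map (class_partial_sum b I) [1..<k])"
proof -
  define R where "R = {(i, j). i < n + 2 \<and> j < n + 2 \<and> q $ i = q $ j}"
  have bij: "bij_betw I {1..k} ({..<n + 2} // R)"
    and ord: "\<And>l m i j. 1 \<le> l \<Longrightarrow> l < m \<Longrightarrow> m \<le> k \<Longrightarrow> i \<in> I l \<Longrightarrow> j \<in> I m \<Longrightarrow> i < j"
    using I unfolding ordered_classes_def R_def dim by auto
  have R: "equiv {..<n + 2} R" by (auto simp: R_def equiv_def refl_on_def sym_def trans_def)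
  have cls: "I (Suc l) \<in> {..<n + 2} // R" if "l < k" for l
    using bij that by (auto simp: bij_betw_def)
  have sub: "i < n + 2" if "l < k" "i \<in> I (Suc l)" for l i
    using in_quotient_imp_subset[OF R cls[OF that(1)]] that(2) by auto
  have "\<exists>i. i \<in> I (Suc l)" if "l < k" for l
    using in_quotient_imp_non_empty[OF R cls[OF that]] by auto
  then obtain r where r: "\<And>l. l < k \<Longrightarrow> r l \<in> I (Suc l)" by metis
  have same: "q $ i = q $ r l" if "l < k" "i \<in> I (Suc l)" for l i
    using in_quotient_imp_in_rel[OF R cls[OF that(1)], of i "r l"] r that by (auto simp: R_def)
  have group: "(\<Sum>l<k. (\<Sum>j\<in>I (Suc l). b $ j) * u (q $ r l)) = (\<Sum>j<n + 2. b $ j * u (q $ j))" for u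
  proof -
    have "(\<Sum>l<k. (\<Sum>j\<in>I (Suc l). b $ j) * u (q $ r l)) = (\<Sum>l<k. \<Sum>j\<in>I (Suc l). b $ j * u (q $ j))"
      unfolding sum_distrib_right using same by (intro sum.cong refl) auto
    also have "\<dots> = (\<Sum>l = 1..k. \<Sum>j\<in>I l. b $ j * u (q $ j))"
      by (simp add: sum.atLeast1_atMost_eq)
    also have "\<dots> = (\<Sum>X\<in>{..<n + 2} // R. \<Sum>j\<in>X. b $ j * u (q $ j))"
      by (rule sum.reindex_bij_betw[OF bij])
    also have "\<dots> = (\<Sum>j\<in>\<Union>({..<n + 2} // R). b $ j * u (q $ j))"
      using quotient_disj[OF R] finite_equiv_class[OF _ equiv_type[OF R]]
      by (subst sum.Union_disjoint) auto
    also have "\<Union>({..<n + 2} // R) = {..<n + 2}" by (rule Union_quotient[OF R])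
    finally show ?thesis .
  qed
  have "r i \<le> r j" if "i \<le> j" "j < k" for i j
    using ord[of "Suc i" "Suc j" "r i" "r j"] r[of i] r[of j] that by (cases "i = j") auto
  then have "q $ r j \<le> q $ r i" if "i \<le> j" "j < k" for i j
    using mono[of "r i" "r j"] sub[of j "r j"] r that by auto
  then have "num_zeros (trinomial_poly n b q) \<le> sgnvar (map (\<lambda>i. \<Sum>l<i. \<Sum>j\<in>I (Suc l). b $ j) [1..<k])"
    using q sub r by (intro num_zeros_trinomial_poly_le_sgnvar[OF q b group]) auto
  then show ?thesis by (simp add: class_partial_sum_def[abs_def] sum.atLeast1_atMost_eq)
qed

section \<open>The bound for overlapping trinomials\<close>

theorem theorem8:
  fixes n :: nat and A B :: "real mat" and P :: "real vec set" and y1 y2 q b :: "real vec"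
  assumes "A \<in> carrier_mat n (n + 2)"
    and "B \<in> carrier_mat n (n + 2)"
    and "vec_space.rank n A = n"
    and "\<exists>y \<in> mat_kernel A. \<forall>i<n + 2. 0 < y $ i"
    and "\<not> kernel_direct_product A"
    and "kernel_dim (append_ones B) = 1"
    and "coefficient_polytope A P"
    and "polytope_vertices P = {y1, y2}"
    and "q = vertex_quotient y1 y2"
    and "q $ 0 = 1"
    and "\<And>i. i < n + 1 \<Longrightarrow> q $ i \<ge> q $ (i + 1)"
    and "q $ (n + 1) = -1"
    and "b \<in> carrier_vec (n + 2)"
    and "mat_kernel (append_ones B) = {c \<cdot>\<^sub>v b | c. True}"
    and "finite (positive_solutions A B)"
  shows "Polynomial.degree (trinomial_poly n b q) \<le> n \<and>
    card (positive_solutions A B) \<le> 1 + num_zeros (trinomial_poly n b q) \<and>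
    num_zeros (trinomial_poly n b q) \<le> sgnvar (map (partial_sum b) [1..<n + 2]) \<and>
    (\<forall>k I. ordered_classes q k I \<longrightarrow>
      num_zeros (trinomial_poly n b q) \<le> sgnvar (map (class_partial_sum b I) [1..<k]))"
proof -
  note A = assms(1) and B = assms(2) and rank = assms(3) and q_def = assms(9)
    and q_first = assms(10) and q_last = assms(12) and b = assms(13) and ker = assms(14)
  have "P \<subseteq> coefficient_cone A"
    using assms(7) unfolding coefficient_polytope_def by auto
  moreover have "{y1, y2} \<subseteq> P"
    unfolding assms(8)[symmetric] by (auto simp: polytope_vertices_def)
  ultimately have cone: "y1 \<in> coefficient_cone A" "y2 \<in> coefficient_cone A" by auto
  then have y: "y1 \<in> mat_kernel A" "y2 \<in> mat_kernel A"
    and nonneg: "\<And>k. k < n + 2 \<Longrightarrow> 0 \<le> y1 $ k" "\<And>k. k < n + 2 \<Longrightarrow> 0 \<le> y2 $ k"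
    using A by (auto simp: coefficient_cone_def)
  have yc: "y1 \<in> carrier_vec (n + 2)" "y2 \<in> carrier_vec (n + 2)"
    and yker: "A *\<^sub>v y1 = 0\<^sub>v n" "A *\<^sub>v y2 = 0\<^sub>v n"
    using y mat_kernelD[OF A] by auto
  have dim: "dim_vec q = n + 2" using yc by (simp add: q_def vertex_quotient_def)
  have q_k: "q $ k = (y1 $ k - y2 $ k) / (y1 $ k + y2 $ k)" if "k < n + 2" for k
    using that yc by (simp add: q_def vertex_quotient_def)
  have ends: "0 < y1 $ 0" "y2 $ 0 = 0" "y1 $ (n + 1) = 0" "0 < y2 $ (n + 1)"
    using q_k[of 0] q_k[of "n + 1"] q_first q_last nonneg[of 0] nonneg[of "n + 1"]
    by (auto simp: divide_eq_eq split: if_splits)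
  have param: "\<exists>\<mu>>0. \<exists>t. -1 < t \<and> t < 1 \<and>
    (\<forall>k<n + 2. y $ k = \<mu> * (y1 $ k + y2 $ k + t * (y1 $ k - y2 $ k)))"
    if "y \<in> mat_kernel A" "\<And>k. k < n + 2 \<Longrightarrow> 0 < y $ k" for y
    by (rule positive_kernel_param[OF A rank y, of 0 "n + 1"]) (use ends that in auto)
  have e_pos: "0 < y1 $ k + y2 $ k" if k: "k < n + 2" for k
  proof (rule ccontr)
    assume "\<not> ?thesis"
    then have "y1 $ k = 0" "y2 $ k = 0" using nonneg[OF k] by auto
    moreover obtain z where "z \<in> mat_kernel A" "\<forall>i<n + 2. 0 < z $ i" using assms(4) by blast
    ultimately show False using param[of z] k by fastforce
  qed
  have q_e: "(y1 $ k + y2 $ k) * (1 + t * q $ k) = y1 $ k + y2 $ k + t * (y1 $ k - y2 $ k)"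
    if "k < n + 2" for t k
  proof -
    have "(y1 $ k + y2 $ k) * q $ k = y1 $ k - y2 $ k" using q_k[OF that] e_pos[OF that] by simp
    moreover have "(y1 $ k + y2 $ k) * (1 + t * q $ k) = y1 $ k + y2 $ k + t * ((y1 $ k + y2 $ k) * q $ k)"
      by (simp add: algebra_simps)
    ultimately show ?thesis by simp
  qed
  have mono: "q $ j \<le> q $ i" if "i \<le> j" "j < n + 2" for i j
    using that assms(11) by (induction rule: dec_induct) (auto intro: order_trans)
  have q_bd: "-1 \<le> q $ k \<and> q $ k \<le> 1" if "k < n + 2" for k
    using mono[of 0 k] mono[of k "n + 1"] q_first q_last that by simp
  have b_ker: "b \<in> mat_kernel (append_ones B)"
    unfolding ker by (auto intro: exI[of _ 1])
  have b_sum: "(\<Sum>j<n + 2. b $ j) = 0" by (rule sum_eq_0_of_append_ones_kernel[OF B b_ker])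

  have sol: "x \<in> positive_solutions A B \<longleftrightarrow>
    (\<exists>t w. -1 < t \<and> t < 1 \<and> w \<in> carrier_vec (n + 1) \<and>
      (append_ones B)\<^sup>T *\<^sub>v w = vec (n + 2) (\<lambda>k. ln ((y1 $ k + y2 $ k) * (1 + t * q $ k))) \<and>
      x = vec n (\<lambda>i. exp (w $ i)))" for x
  proof (rule positive_solutions_iff_log[OF A B])
    show "0 < (y1 $ k + y2 $ k) * (1 + t * q $ k)" if "-1 < t" "t < 1" "k < n + 2" for t k
      using e_pos[OF that(3)] one_plus_mult_pos[OF that(1,2)] q_bd[OF that(3)] by simp
    fix y :: "real vec" assume yy: "y \<in> carrier_vec (n + 2)" "\<And>k. k < n + 2 \<Longrightarrow> 0 < y $ k"
    show "A *\<^sub>v y = 0\<^sub>v n \<longleftrightarrow> (\<exists>\<mu>>0. \<exists>t. -1 < t \<and> t < 1 \<and>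
      (\<forall>k<n + 2. y $ k = \<mu> * ((y1 $ k + y2 $ k) * (1 + t * q $ k))))"
    proof
      assume "A *\<^sub>v y = 0\<^sub>v n"
      from param[OF mat_kernelI[OF A yy(1) this] yy(2)]
      show "\<exists>\<mu>>0. \<exists>t. -1 < t \<and> t < 1 \<and>
        (\<forall>k<n + 2. y $ k = \<mu> * ((y1 $ k + y2 $ k) * (1 + t * q $ k)))"
        using q_e by simp
    next
      assume "\<exists>\<mu>>0. \<exists>t. -1 < t \<and> t < 1 \<and>
        (\<forall>k<n + 2. y $ k = \<mu> * ((y1 $ k + y2 $ k) * (1 + t * q $ k)))"
      then obtain \<mu> t where lt: "\<And>k. k < n + 2 \<Longrightarrow> y $ k = \<mu> * (y1 $ k + y2 $ k + t * (y1 $ k - y2 $ k))"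
        using q_e by auto
      have "y = (\<mu> * (1 + t)) \<cdot>\<^sub>v y1 + (\<mu> * (1 - t)) \<cdot>\<^sub>v y2"
        using yy(1) yc lt by (intro eq_vecI) (auto simp: algebra_simps)
      then show "A *\<^sub>v y = 0\<^sub>v n"
        using A yc yker
        by (auto simp: mult_add_distrib_mat_vec[OF A] mult_mat_vec[OF A] intro!: eq_vecI)
    qed
  qed
  let ?p = "trinomial_poly n b q"
  let ?D = "\<lambda>t. \<Sum>k<n + 2. b $ k * (q $ k / (1 + t * q $ k))"
  have p_zero: "poly ?p t = 0 \<longleftrightarrow> ?D t = 0" if t: "-1 < t" "t < 1" for t
    by (rule poly_trinomial_poly_eq_0_iff[OF q_bd t b_sum])
  have "card (positive_solutions A B) \<le> 1 + num_zeros ?p"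
  proof (cases "?p = 0")
    case True
    then have D0: "?D t = 0" if "-1 < t" "t < 1" for t
      unfolding p_zero[OF that, symmetric] by simp
    have "positive_solutions A B = {}"
      by (rule card_positive_solutions_le_card_zeros(2)
          [OF B b ker e_pos q_bd q_first q_last sol assms(15) D0])
    then show ?thesis by simp
  next
    case False
    have Z: "{t. -1 < t \<and> t < 1 \<and> poly ?p t = 0} = {t. -1 < t \<and> t < 1 \<and> ?D t = 0}"
      using p_zero by blast
    have fin: "finite {t. -1 < t \<and> t < 1 \<and> ?D t = 0}"
      unfolding Z[symmetric] by (rule finite_subset[OF _ poly_roots_finite[OF False]]) blast
    have "card (positive_solutions A B) \<le> Suc (card {t. -1 < t \<and> t < 1 \<and> ?D t = 0})"
      by (rule card_positive_solutions_le_card_zeros(1)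
          [OF B b ker e_pos q_bd q_first q_last sol assms(15) fin])
    then show ?thesis unfolding Z[symmetric] using False by (simp add: num_zeros_def)
  qed
  moreover have "num_zeros ?p \<le> sgnvar (map (partial_sum b) [1..<n + 2])"
    unfolding partial_sum_def[abs_def]
    by (rule num_zeros_trinomial_poly_le_sgnvar[where x = "\<lambda>j. q $ j" and \<beta> = "\<lambda>j. b $ j",
          OF q_bd b_sum refl mono q_bd])
  moreover have "num_zeros ?p \<le> sgnvar (map (class_partial_sum b I) [1..<k])"
    if "ordered_classes q k I" for k I
    by (rule num_zeros_trinomial_poly_le_sgnvar_classes[OF dim mono q_bd b_sum that])
  ultimately show ?thesis using degree_trinomial_poly_le by blast
qed

end
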